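(* Let $n \geq 1$ and let $f, g \in \mathbb{R}[x_1,\ldots,x_n]$ be multiaffine polynomials with $\mathrm{Newt}(f) = \mathrm{Newt}(g) = \mathrm{Conv}(\{0,1\}^n)$ and generic coefficients. Then the algebraic degree of the optimization problem $\min_{x \in \mathbb{R}^n} g(x)$ subject to $f(x) = 0$ is $!(n+1)$, the number of derangements (permutations without fixed points) of the set $\{0,1,\ldots,n\}$.
   Context: For a polynomial $f = \sum_{\alpha\in\mathcal{A}} c_\alpha x^\alpha$ with monomial support $\mathcal{A}\subset\mathbb{N}^n$, $\mathrm{Newt}(f) = \mathrm{Conv}\{\alpha : \alpha\in\mathcal{A}\}$. The Lagrange system of $\min g$ s.t. $f=0$ is $\mathcal{L}_{g,f} = \{\ell_1,\ldots,\ell_n,f\}$ with $\ell_i = \frac{\partial}{\partial x_i}(g - \lambda f)$, in the unknowns $(x,\lambda)$. The algebraic degree of the problem is the number of complex solutions $(x,\lambda)\in\mathbb{C}^{n+1}$ of $\mathcal{L}_{g,f}=0$. "Generic" coefficients means lying outside some proper algebraic subvariety of the complex parameter space of coefficients. *)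

theory Defs
  imports
    "HOL-Analysis.Analysis"
    "HOL-Library.Poly_Mapping"
    "HOL-Combinatorics.Permutations"
begin

text \<open>Polynomials with variables indexed by \<open>'n\<close> and coefficients in \<open>'a\<close>: finitely supported
  coefficient functions on monomials, a monomial being its (finitely supported) exponent vector.
  The ring structure is the convolution structure of \<^theory>\<open>HOL-Library.Poly_Mapping\<close>.\<close>

type_synonym ('n, 'a) mpoly = "('n \<Rightarrow>\<^sub>0 nat) \<Rightarrow>\<^sub>0 'a"

definition mpoly_eval :: "('n, 'a::comm_semiring_1) mpoly \<Rightarrow> ('n \<Rightarrow> 'a) \<Rightarrow> 'a" where
  "mpoly_eval p x =
     (\<Sum>\<alpha>\<in>Poly_Mapping.keys p. Poly_Mapping.lookup p \<alpha> *
        (\<Prod>i\<in>Poly_Mapping.keys \<alpha>. x i ^ Poly_Mapping.lookup \<alpha> i))"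

text \<open>Subtraction of exponent vectors truncates at 0, but it only does so in terms with
  coefficient 0.\<close>

definition mpoly_partial :: "'n \<Rightarrow> ('n, 'a::comm_semiring_1) mpoly \<Rightarrow> ('n, 'a) mpoly" where
  "mpoly_partial i p =
     (\<Sum>\<alpha>\<in>Poly_Mapping.keys p.
        Poly_Mapping.single (\<alpha> - Poly_Mapping.single i 1)
          (of_nat (Poly_Mapping.lookup \<alpha> i) * Poly_Mapping.lookup p \<alpha>))"

definition multiaffine :: "('n, 'a::zero) mpoly \<Rightarrow> bool" where
  "multiaffine p \<longleftrightarrow> (\<forall>\<alpha>\<in>Poly_Mapping.keys p. \<forall>i. Poly_Mapping.lookup \<alpha> i \<le> 1)"

definition Newt :: "('n::finite, 'a::zero) mpoly \<Rightarrow> (real ^ 'n) set" where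
  "Newt p = convex hull ((\<lambda>\<alpha>. \<chi> i. real (Poly_Mapping.lookup \<alpha> i)) ` Poly_Mapping.keys p)"

definition complexify :: "('n, real) mpoly \<Rightarrow> ('n, complex) mpoly" where
  "complexify p = Poly_Mapping.map complex_of_real p"

text \<open>\<open>lagrange_poly g f \<mu> i\<close> is \<open>\<partial>(g - \<mu> f)/\<partial>x\<^sub>i\<close>; since the derivative is taken in \<open>x\<close> only, the
  multiplier (written \<open>\<mu>\<close>) enters as a scalar, i.e. as the constant polynomial \<open>Poly_Mapping.single 0 \<mu>\<close>.\<close>

definition lagrange_poly ::
    "('n, real) mpoly \<Rightarrow> ('n, real) mpoly \<Rightarrow> complex \<Rightarrow> 'n \<Rightarrow> ('n, complex) mpoly" where
  "lagrange_poly g f \<mu> i =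
     mpoly_partial i (complexify g - Poly_Mapping.single 0 \<mu> * complexify f)"

definition lagrange_solutions ::
    "('n::finite, real) mpoly \<Rightarrow> ('n, real) mpoly \<Rightarrow> ((complex ^ 'n) \<times> complex) set" where
  "lagrange_solutions g f =
     {(x, \<mu>). (\<forall>i. mpoly_eval (lagrange_poly g f \<mu> i) (($) x) = 0) \<and>
              mpoly_eval (complexify f) (($) x) = 0}"

text \<open>Algebraic degree of the problem of minimising \<open>g\<close> subject to \<open>f = 0\<close>. As \<^const>\<open>card\<close> is 0 on
  infinite sets, this is meaningful only together with finiteness of the solution set.\<close>

definition algebraic_degree :: "('n::finite, real) mpoly \<Rightarrow> ('n, real) mpoly \<Rightarrow> nat" where
  "algebraic_degree g f = card (lagrange_solutions g f)"

text \<open>Algebraic subvarieties of affine space, not required to be irreducible.\<close>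

definition algebraic_subvariety :: "(complex ^ 'k) set \<Rightarrow> bool" where
  "algebraic_subvariety V \<longleftrightarrow>
     (\<exists>F :: ('k, complex) mpoly set. V = {c. \<forall>p\<in>F. mpoly_eval p (($) c) = 0})"

text \<open>The multiaffine monomials are the \<open>\<Prod>i\<in>S. x\<^sub>i\<close> for \<open>S :: 'n set\<close>, so the parameter
  space of pairs of multiaffine polynomials has the coordinates \<open>'n set + 'n set\<close>: \<open>Inl S\<close> for the
  coefficients of \<open>f\<close>, \<open>Inr S\<close> for those of \<open>g\<close>.\<close>

definition multiaffine_monomial :: "'n::finite set \<Rightarrow> ('n \<Rightarrow>\<^sub>0 nat)" where
  "multiaffine_monomial S = (\<Sum>i\<in>S. Poly_Mapping.single i 1)"

definition coeff_point ::
    "('n::finite, real) mpoly \<Rightarrow> ('n, real) mpoly \<Rightarrow> complex ^ ('n set + 'n set)" where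
  "coeff_point f g =
     (\<chi> k. case k of
        Inl S \<Rightarrow> complex_of_real (Poly_Mapping.lookup f (multiaffine_monomial S))
      | Inr S \<Rightarrow> complex_of_real (Poly_Mapping.lookup g (multiaffine_monomial S)))"

definition derangements :: "'a set \<Rightarrow> ('a \<Rightarrow> 'a) set" where
  "derangements A = {\<pi>. \<pi> permutes A \<and> (\<forall>a\<in>A. \<pi> a \<noteq> a)}"

end

theory Submission
  imports Defs "HOL-Computational_Algebra.Polynomial"
begin

text \<open>Treat the multiplier as one more variable. Then \<open>H = g - \<mu> f\<close> is multiaffine in \<open>m = n + 1\<close>
variables, its coefficients are up to sign those of \<open>f\<close> and \<open>g\<close>, and the Lagrange system
says that all partial derivatives of \<open>H\<close> vanish, the derivative in \<open>\<mu>\<close> being \<open>- f\<close>. The \<open>i\<close>-th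
derivative is multiaffine and does not involve the \<open>i\<close>-th variable, so the multihomogeneous Bezout
number of the system on \<open>(P\<^sup>1)\<^sup>m\<close> is the permanent of the 0/1 matrix whose only zeros are on the
diagonal. This permanent counts derangements.

The proof that generic coefficients attain this number is a deformation argument. It takes place in
the larger family of all systems of \<open>m\<close> multiaffine equations in which the \<open>i\<close>-th equation
avoids the \<open>i\<close>-th variable and all coefficients are independent. A system is called
nondegenerate when it has no zero at infinity in \<open>(P\<^sup>1)\<^sup>m\<close> and all its affine zeros are simple.

\<^item> By compactness of \<open>(P\<^sup>1)\<^sup>m\<close> and the inverse function theorem, the number of zeros is locally
  constant near a nondegenerate system (\<open>sols_locally_constant\<close>). A complex line minus finitely many
  points is connected, so two nondegenerate systems have equally many zeros if almost all systems
  on the line through them are nondegenerate (\<open>card_sols_eq_along_line\<close>).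

\<^item> The system \<open>\<Prod>\<^bsub>j \<noteq> i\<^esub> (y\<^sub>j - \<alpha>\<^sub>i) = 0\<close> with distinct \<open>\<alpha>\<^sub>i\<close> is nondegenerate, and its zeros
  correspond to the derangements (\<open>card_sols_product_system\<close>).

\<^item> A degenerate system and one of its bad zeros are together described by a point of a
  hypersurface in an affine space of the same dimension as the space of systems. A count of monomials
  shows that the image of a hypersurface under a polynomial map between spaces of equal dimension
  satisfies a nontrivial polynomial equation (\<open>polynomial_image_of_hypersurface\<close>). This is carried out
  both for all systems (\<open>generic_system_nondegenerate\<close>) and for gradient systems
  (\<open>generic_gradient_system_nondegenerate\<close>). The second case does not follow from the first,
  because gradient systems form a proper linear subspace.

A nondegenerate gradient system and the product system are both joined by lines to one
generic system, and therefore all three have the same number of zeros. The exceptional variety is the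
zero set of the polynomial obtained for gradient systems, written in the coefficients of \<open>f\<close> and \<open>g\<close>.\<close>

section \<open>Polynomial functions\<close>

inductive polyfun :: "(('k \<Rightarrow> complex) \<Rightarrow> complex) \<Rightarrow> bool" where
  const: "polyfun (\<lambda>x. a)"
| var: "polyfun (\<lambda>x. x i)"
| add: "polyfun p \<Longrightarrow> polyfun q \<Longrightarrow> polyfun (\<lambda>x. p x + q x)"
| mult: "polyfun p \<Longrightarrow> polyfun q \<Longrightarrow> polyfun (\<lambda>x. p x * q x)"

lemma polyfun_uminus: "polyfun p \<Longrightarrow> polyfun (\<lambda>x. - p x)"
  using polyfun.mult[OF polyfun.const[of "-1"], of p] by simp

lemma polyfun_sum: "(\<And>a. a \<in> A \<Longrightarrow> polyfun (p a)) \<Longrightarrow> polyfun (\<lambda>x. \<Sum>a\<in>A. p a x)"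
  by (induction A rule: infinite_finite_induct) (auto intro: polyfun.intros)

lemma polyfun_prod: "(\<And>a. a \<in> A \<Longrightarrow> polyfun (p a)) \<Longrightarrow> polyfun (\<lambda>x. \<Prod>a\<in>A. p a x)"
  by (induction A rule: infinite_finite_induct) (auto intro: polyfun.intros)

lemma polyfun_compose:
  assumes "polyfun D" and "\<And>j. polyfun (\<lambda>x. \<phi> x j)"
  shows "polyfun (\<lambda>x. D (\<phi> x))"
  using assms(1) by induction (auto intro: polyfun.intros assms(2))

lemmas polyfun_intros = polyfun.intros polyfun_uminus polyfun_sum polyfun_prod

lemma polyfun_on_line:
  assumes "polyfun p"
  shows "\<exists>P :: complex poly. \<forall>t. p (\<lambda>i. a i + t * b i) = poly P t"
  using assms
proof induction
  case (const c)
  show ?case by (rule exI[of _ "[:c:]"]) simp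
next
  case (var i)
  show ?case by (rule exI[of _ "[:a i, b i:]"]) simp
next
  case (add p q)
  then obtain P Q where "\<forall>t. p (\<lambda>i. a i + t * b i) = poly P t"
    "\<forall>t. q (\<lambda>i. a i + t * b i) = poly Q t" by blast
  then show ?case by (intro exI[of _ "P + Q"]) simp
next
  case (mult p q)
  then obtain P Q where "\<forall>t. p (\<lambda>i. a i + t * b i) = poly P t"
    "\<forall>t. q (\<lambda>i. a i + t * b i) = poly Q t" by blast
  then show ?case by (intro exI[of _ "P * Q"]) simp
qed

lemma polyfun_finite_zeros_on_line:
  assumes "polyfun p" and "p y \<noteq> 0"
  shows "finite {t. p (\<lambda>i. x i + t * (y i - x i)) = 0}"
proof -
  obtain P :: "complex poly" where P: "\<And>t. p (\<lambda>i. x i + t * (y i - x i)) = poly P t"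
    using polyfun_on_line[OF assms(1), of x "\<lambda>i. y i - x i"] by auto
  have "poly P 1 \<noteq> 0" using assms(2) by (simp flip: P)
  then have "P \<noteq> 0" by auto
  then show ?thesis by (simp add: P poly_roots_finite)
qed

text \<open>Over an infinite field the ring of polynomial functions has no zero divisors: on the line
through a point where \<open>p\<close> does not vanish and one where \<open>q\<close> does not, each of them has
only finitely many zeros.\<close>

lemma polyfun_mult_nonzero:
  assumes "polyfun p" "polyfun q" "p x \<noteq> 0" "q y \<noteq> 0"
  shows "\<exists>z. p z * q z \<noteq> 0"
proof -
  let ?l = "\<lambda>t i. x i + t * (y i - x i)" and ?l' = "\<lambda>t i. y i + t * (x i - y i)"
  have "finite {t. q (?l t) = 0}"
    using polyfun_finite_zeros_on_line[of q y, OF assms(2,4)] .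
  moreover have "finite {t. p (?l t) = 0}"
  proof -
    have "{t. p (?l t) = 0} \<subseteq> (\<lambda>t. 1 - t) ` {t. p (?l' t) = 0}"
    proof
      fix t assume "t \<in> {t. p (?l t) = 0}"
      moreover have "?l' (1 - t) = ?l t" by (auto simp: algebra_simps)
      ultimately have "1 - t \<in> {t. p (?l' t) = 0}" by simp
      then have "1 - (1 - t) \<in> (\<lambda>t. 1 - t) ` {t. p (?l' t) = 0}" by blast
      then show "t \<in> (\<lambda>t. 1 - t) ` {t. p (?l' t) = 0}" by simp
    qed
    then show ?thesis
      using polyfun_finite_zeros_on_line[of p x y, OF assms(1,3)] by (meson finite_imageI finite_subset)
  qed
  ultimately have "finite ({t. p (?l t) = 0} \<union> {t. q (?l t) = 0})" by simp
  then obtain t where "t \<notin> {t. p (?l t) = 0} \<union> {t. q (?l t) = 0}"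
    using ex_new_if_finite[OF infinite_UNIV_char_0] by blast
  then show ?thesis by auto
qed

lemma polyfun_prod_nonzero:
  assumes "finite A" "\<forall>a\<in>A. polyfun (p a) \<and> (\<exists>x. p a x \<noteq> 0)"
  shows "\<exists>x. (\<Prod>a\<in>A. p a x) \<noteq> 0"
  using assms
proof (induction A)
  case empty
  show ?case by simp
next
  case (insert a A)
  have pa: "polyfun (p a)" using insert.prems by simp
  have pA: "polyfun (\<lambda>x. \<Prod>a\<in>A. p a x)" by (rule polyfun_prod) (use insert.prems in simp)
  obtain x where x: "p a x \<noteq> 0" using insert.prems by auto
  have "\<exists>x. (\<Prod>a\<in>A. p a x) \<noteq> 0" using insert by simp
  then obtain y where y: "(\<Prod>a\<in>A. p a y) \<noteq> 0" ..
  obtain z where "p a z * (\<Prod>a\<in>A. p a z) \<noteq> 0"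
    using polyfun_mult_nonzero[of "p a" "\<lambda>x. \<Prod>a\<in>A. p a x" x y, OF pa pA x y] ..
  then have "(\<Prod>a\<in>insert a A. p a z) \<noteq> 0" using insert.hyps by simp
  then show ?case by (rule exI[of _ z])
qed

section \<open>Degree bounds and images of hypersurfaces\<close>

text \<open>The degree is bounded in each variable separately. The exponents then form a box, whose size is
known exactly, and multiplication by a fixed polynomial enlarges the box only by the degrees of that
polynomial.\<close>

definition polydeg :: "('k::finite \<Rightarrow> nat) \<Rightarrow> (('k \<Rightarrow> complex) \<Rightarrow> complex) \<Rightarrow> bool" where
  "polydeg v p \<longleftrightarrow> (\<exists>d. \<forall>x. p x = (\<Sum>\<alpha>\<in>{..v}. d \<alpha> * (\<Prod>i\<in>UNIV. x i ^ \<alpha> i)))"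

lemma polydegI:
  "(\<And>x. p x = (\<Sum>\<alpha>\<in>{..v}. d \<alpha> * (\<Prod>i\<in>UNIV. x i ^ \<alpha> i))) \<Longrightarrow> polydeg v p"
  unfolding polydeg_def by blast

lemma atMost_fun_eq: "{..v :: 'k \<Rightarrow> nat} = Pi\<^sub>E UNIV (\<lambda>i. {..v i})"
  by (auto simp: le_fun_def PiE_def Pi_iff)

lemma finite_atMost_fun [simp]: "finite {..v :: 'k::finite \<Rightarrow> nat}"
  unfolding atMost_fun_eq by (intro finite_PiE) auto

lemma card_atMost_const_fun: "card {..(\<lambda>_::'k::finite. n :: nat)} = (n + 1) ^ CARD('k)"
  unfolding atMost_fun_eq by (subst card_PiE) auto

lemma polydeg_mono:
  assumes "polydeg v p" "v \<le> w"
  shows "polydeg w p"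
proof -
  obtain d where d: "\<And>x. p x = (\<Sum>\<alpha>\<in>{..v}. d \<alpha> * (\<Prod>i\<in>UNIV. x i ^ \<alpha> i))"
    using assms unfolding polydeg_def by blast
  have "p x = (\<Sum>\<alpha>\<in>{..w}. (if \<alpha> \<le> v then d \<alpha> else 0) * (\<Prod>i\<in>UNIV. x i ^ \<alpha> i))" for x
    unfolding d using assms(2) by (intro sum.mono_neutral_cong_left) auto
  then show ?thesis by (rule polydegI)
qed

lemma polydeg_const: "polydeg v (\<lambda>x. a)"
proof -
  have "polydeg (\<lambda>_. 0) (\<lambda>x::'a \<Rightarrow> complex. a)"
  proof -
    have "{..(\<lambda>_::'a. 0::nat)} = {\<lambda>_. 0}" by (auto simp: le_fun_def)
    then show ?thesis unfolding polydeg_def by (intro exI[of _ "\<lambda>_. a"]) simp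
  qed
  then show ?thesis by (rule polydeg_mono) (auto simp: le_fun_def)
qed

lemma polydeg_var: "polydeg (\<lambda>j. if j = i then 1 else 0) (\<lambda>x. x i)"
proof -
  let ?e = "\<lambda>j. if j = i then 1 else 0 :: nat"
  have "x i = (\<Sum>\<alpha>\<in>{..?e}. (if \<alpha> = ?e then 1 else 0) * (\<Prod>k\<in>UNIV. x k ^ \<alpha> k))"
    for x :: "'a \<Rightarrow> complex"
  proof -
    have "(\<Sum>\<alpha>\<in>{..?e}. (if \<alpha> = ?e then 1 else 0) * (\<Prod>k\<in>UNIV. x k ^ \<alpha> k))
      = (\<Sum>\<alpha>\<in>{..?e}. if ?e = \<alpha> then (\<Prod>k\<in>UNIV. x k ^ \<alpha> k) else 0)"
      by (intro sum.cong) auto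
    also have "\<dots> = (\<Prod>k\<in>UNIV. x k ^ ?e k)" by (subst sum.delta') auto
    also have "\<dots> = (\<Prod>k\<in>UNIV. if k = i then x k else 1)" by (intro prod.cong) auto
    also have "\<dots> = x i" by simp
    finally show ?thesis by simp
  qed
  then show ?thesis by (rule polydegI)
qed

lemma polydeg_add:
  assumes "polydeg v p" "polydeg v q"
  shows "polydeg v (\<lambda>x. p x + q x)"
proof -
  obtain d e where "\<And>x. p x = (\<Sum>\<alpha>\<in>{..v}. d \<alpha> * (\<Prod>i\<in>UNIV. x i ^ \<alpha> i))"
    "\<And>x. q x = (\<Sum>\<alpha>\<in>{..v}. e \<alpha> * (\<Prod>i\<in>UNIV. x i ^ \<alpha> i))"
    using assms unfolding polydeg_def by blast
  then show ?thesis unfolding polydeg_def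
    by (intro exI[of _ "\<lambda>\<alpha>. d \<alpha> + e \<alpha>"]) (simp add: algebra_simps sum.distrib)
qed

lemma polydeg_mult:
  assumes "polydeg v p" "polydeg w q"
  shows "polydeg (\<lambda>i. v i + w i) (\<lambda>x. p x * q x)"
proof -
  let ?m = "\<lambda>x \<alpha>. \<Prod>i\<in>UNIV. x i ^ \<alpha> i :: complex"
  let ?a = "\<lambda>(\<alpha>, \<beta>) i. \<alpha> i + \<beta> i :: nat"
  obtain d e where d: "\<And>x. p x = (\<Sum>\<alpha>\<in>{..v}. d \<alpha> * ?m x \<alpha>)"
    and e: "\<And>x. q x = (\<Sum>\<alpha>\<in>{..w}. e \<alpha> * ?m x \<alpha>)"
    using assms unfolding polydeg_def by blast
  define c where "c \<gamma> = (\<Sum>z\<in>{z \<in> {..v} \<times> {..w}. ?a z = \<gamma>}. d (fst z) * e (snd z))" for \<gamma>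
  have "p x * q x = (\<Sum>\<gamma>\<in>{..\<lambda>i. v i + w i}. c \<gamma> * ?m x \<gamma>)" for x
  proof -
    have "p x * q x = (\<Sum>z\<in>{..v} \<times> {..w}. d (fst z) * e (snd z) * ?m x (?a z))"
      unfolding d e sum_product sum.cartesian_product
      by (intro sum.cong) (auto simp: power_add prod.distrib)
    also have "\<dots> = (\<Sum>\<gamma>\<in>{..\<lambda>i. v i + w i}.
        \<Sum>z\<in>{z \<in> {..v} \<times> {..w}. ?a z = \<gamma>}. d (fst z) * e (snd z) * ?m x (?a z))"
      by (rule sum.group[symmetric]) (auto simp: le_fun_def add_mono)
    also have "\<dots> = (\<Sum>\<gamma>\<in>{..\<lambda>i. v i + w i}. c \<gamma> * ?m x \<gamma>)"
      unfolding c_def sum_distrib_right by (intro sum.cong) auto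
    finally show ?thesis .
  qed
  then show ?thesis by (rule polydegI)
qed

lemma polydeg_prod:
  assumes "\<And>a. a \<in> A \<Longrightarrow> polydeg (v a) (p a)"
  shows "polydeg (\<lambda>i. \<Sum>a\<in>A. v a i) (\<lambda>x. \<Prod>a\<in>A. p a x)"
  using assms
proof (induction A rule: infinite_finite_induct)
  case (insert a A)
  then show ?case using polydeg_mult[of "v a" "p a" "\<lambda>i. \<Sum>a\<in>A. v a i" "\<lambda>x. \<Prod>a\<in>A. p a x"] by simp
qed (auto intro: polydeg_const)

lemma polyfun_imp_polydeg:
  fixes p :: "('k::finite \<Rightarrow> complex) \<Rightarrow> complex"
  assumes "polyfun p"
  shows "\<exists>n. polydeg (\<lambda>_. n) p"
  using assms
proof induction
  case (const a)
  show ?case by (rule exI[of _ 0]) (rule polydeg_const)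
next
  case (var i)
  show ?case by (rule exI[of _ 1], rule polydeg_mono[OF polydeg_var]) (auto simp: le_fun_def)
next
  case (add p q)
  then obtain m n where "polydeg (\<lambda>_. m) p" "polydeg (\<lambda>_. n) q" by blast
  then have "polydeg (\<lambda>_. m + n) p" "polydeg (\<lambda>_. m + n) q"
    by (auto elim!: polydeg_mono simp: le_fun_def)
  from polydeg_add[OF this] show ?case by blast
next
  case (mult p q)
  then obtain m n where "polydeg (\<lambda>_. m) p" "polydeg (\<lambda>_. n) q" by blast
  from polydeg_mult[OF this] show ?case by blast
qed

text \<open>Up to a scalar, this is the Lagrange interpolation polynomial at the node \<open>\<beta>\<close> of the grid
\<open>{0..n}\<^sup>k\<close>. With this basis, evaluation at the nodes shows that a nontrivial linear
combination is a nonzero function.\<close>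

definition grid_poly :: "nat \<Rightarrow> ('k::finite \<Rightarrow> nat) \<Rightarrow> ('k \<Rightarrow> complex) \<Rightarrow> complex" where
  "grid_poly n \<beta> x = (\<Prod>i\<in>UNIV. \<Prod>l\<in>{..n} - {\<beta> i}. x i - of_nat l)"

lemma polyfun_grid_poly: "polyfun (grid_poly n \<beta>)"
proof -
  have "polyfun (\<lambda>x. x i + (- of_nat l))" for i :: 'a and l by (intro polyfun.intros)
  then show ?thesis unfolding grid_poly_def by (intro polyfun_prod) simp
qed

lemma polydeg_grid_poly:
  fixes \<beta> :: "'k::finite \<Rightarrow> nat"
  assumes "\<beta> \<le> (\<lambda>_. n)"
  shows "polydeg (\<lambda>_. n) (grid_poly n \<beta>)"
proof -
  let ?e = "\<lambda>i j. if j = i then 1 else 0 :: nat"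
  have lin: "polydeg (?e i) (\<lambda>x. x i - of_nat l)" for i :: 'k and l :: nat
    using polydeg_add[OF polydeg_var polydeg_const, of i "- of_nat l"] by simp
  have "polydeg (\<lambda>j. \<Sum>i\<in>UNIV. \<Sum>l\<in>{..n} - {\<beta> i}. ?e i j)
      (\<lambda>x. \<Prod>i\<in>UNIV. \<Prod>l\<in>{..n} - {\<beta> i}. x i - of_nat l)"
    by (intro polydeg_prod lin)
  moreover have "(\<Sum>i\<in>UNIV. \<Sum>l\<in>{..n} - {\<beta> i}. ?e i j) = n" for j
  proof -
    have "card ({..n} - {\<beta> i}) = n" for i
      using assms by (simp add: le_fun_def)
    then show ?thesis by (simp add: if_distrib cong: if_cong)
  qed
  ultimately show ?thesis unfolding grid_poly_def by simp
qed

lemma grid_poly_at_grid: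
  assumes "\<gamma> \<le> (\<lambda>_. n)"
  shows "grid_poly n \<beta> (\<lambda>i. of_nat (\<gamma> i)) = 0 \<longleftrightarrow> \<beta> \<noteq> \<gamma>"
proof -
  have "grid_poly n \<beta> (\<lambda>i. of_nat (\<gamma> i)) = 0 \<longleftrightarrow> (\<exists>i. \<exists>l\<in>{..n} - {\<beta> i}. \<gamma> i = l)"
    unfolding grid_poly_def by simp
  also have "\<dots> \<longleftrightarrow> (\<exists>i. \<beta> i \<noteq> \<gamma> i)" using assms by (simp add: Bex_def) (metis assms le_fun_def)
  finally show ?thesis by auto
qed

lemma grid_poly_combination_nonzero:
  assumes "\<beta>0 \<le> (\<lambda>_. n)" "d \<beta>0 \<noteq> 0"
  shows "(\<Sum>\<beta>\<in>{..\<lambda>_. n}. d \<beta> * grid_poly n \<beta> (\<lambda>i. of_nat (\<beta>0 i))) \<noteq> 0"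
proof -
  have "(\<Sum>\<beta>\<in>{..\<lambda>_. n}. d \<beta> * grid_poly n \<beta> (\<lambda>i. of_nat (\<beta>0 i)))
     = (\<Sum>\<beta>\<in>{\<beta>0}. d \<beta> * grid_poly n \<beta> (\<lambda>i. of_nat (\<beta>0 i)))"
    using assms by (intro sum.mono_neutral_right) (auto simp: grid_poly_at_grid)
  then show ?thesis using assms by (simp add: grid_poly_at_grid)
qed

lemma underdetermined_system_nontrivial:
  fixes a :: "'j \<Rightarrow> 'i \<Rightarrow> 'c::field"
  assumes "finite J" "finite I" "card J < card I"
  shows "\<exists>x. (\<exists>i\<in>I. x i \<noteq> 0) \<and> (\<forall>j\<in>J. (\<Sum>i\<in>I. a j i * x i) = 0)"
  using assms
proof (induction J arbitrary: a I)
  case empty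
  then obtain i where "i \<in> I" by fastforce
  then show ?case by (intro exI[of _ "\<lambda>_. 1"]) auto
next
  case (insert j J)
  show ?case
  proof (cases "\<forall>i\<in>I. a j i = 0")
    case True
    have "card J < card I" using insert by simp
    from insert.IH[OF insert.prems(1) this, of a] True show ?thesis by auto
  next
    case False
    then obtain k where k: "k \<in> I" "a j k \<noteq> 0" by blast
    define b where "b l i = a l i - a l k * a j i / a j k" for l i
    have "card J < card (I - {k})" using insert k by simp
    then obtain x where x: "\<exists>i\<in>I - {k}. x i \<noteq> 0" "\<forall>l\<in>J. (\<Sum>i\<in>I-{k}. b l i * x i) = 0"
      using insert.IH[of "I - {k}" b] insert.prems by auto
    define s where "s = (\<Sum>i\<in>I-{k}. a j i * x i)"
    define y where "y = x(k := - s / a j k)"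
    have split: "(\<Sum>i\<in>I. a l i * y i) = (\<Sum>i\<in>I-{k}. a l i * x i) - a l k * s / a j k" for l
    proof -
      have "(\<Sum>i\<in>I. a l i * y i) = a l k * y k + (\<Sum>i\<in>I-{k}. a l i * y i)"
        using insert.prems k by (simp add: sum.remove)
      moreover have "(\<Sum>i\<in>I-{k}. a l i * y i) = (\<Sum>i\<in>I-{k}. a l i * x i)"
        by (intro sum.cong) (auto simp: y_def)
      ultimately show ?thesis by (simp add: y_def)
    qed
    have "(\<Sum>i\<in>I. a l i * y i) = 0" if "l \<in> J" for l
    proof -
      have "0 = (\<Sum>i\<in>I-{k}. b l i * x i)" using x that by simp
      also have "\<dots> = (\<Sum>i\<in>I-{k}. a l i * x i) - a l k * s / a j k"
        by (simp add: b_def s_def left_diff_distrib sum_subtractf sum_distrib_left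
            sum_divide_distrib algebra_simps)
      finally show ?thesis by (simp add: split)
    qed
    moreover have "(\<Sum>i\<in>I. a j i * y i) = 0" using k by (simp add: split s_def)
    moreover have "\<exists>i\<in>I. y i \<noteq> 0" using x by (auto simp: y_def)
    ultimately show ?thesis by (intro exI[of _ y]) auto
  qed
qed

text \<open>Bernoulli's inequality for \<open>(1 - e / m)\<^sup>k\<^sup>+\<^sup>1\<close>, cleared of denominators.\<close>

lemma power_le_shifted_power:
  fixes m e k :: nat
  assumes "e \<le> m"
  shows "m ^ Suc k \<le> (m - e) ^ Suc k + Suc k * e * m ^ k"
proof (induction k)
  case 0
  then show ?case using assms by simp
next
  case (Suc k)
  have "m ^ Suc (Suc k) \<le> m * ((m - e) ^ Suc k + Suc k * e * m ^ k)"
    using Suc by (simp del: power_Suc add: power_Suc[of m "Suc k"])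
  also have "\<dots> = (m - e) ^ Suc (Suc k) + e * (m - e) ^ Suc k + Suc k * e * m ^ Suc k"
  proof -
    obtain r where "m = r + e" using assms by (metis add.commute le_Suc_ex)
    then show ?thesis by (simp add: algebra_simps)
  qed
  also have "\<dots> \<le> (m - e) ^ Suc (Suc k) + e * m ^ Suc k + Suc k * e * m ^ Suc k"
    by (intro add_mono mult_left_mono power_mono order_refl) auto
  also have "\<dots> = (m - e) ^ Suc (Suc k) + Suc (Suc k) * e * m ^ Suc k"
    by (simp add: algebra_simps)
  finally show ?case .
qed

text \<open>Polynomials of degree at most \<open>N = E * d\<close> in each of \<open>k\<close> variables, taken modulo multiples of a
polynomial of degree \<open>e\<close>, form a space of dimension \<open>O(N\<^sup>k\<^sup>-\<^sup>1)\<close>. This is eventually smaller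
than the number \<open>(d + 1)\<^sup>k\<close> of monomials of degree at most \<open>d\<close> in each variable.\<close>

lemma box_counting_inequality:
  fixes k e E :: nat
  assumes "0 < k" "0 < E"
  shows "\<exists>d. e \<le> E * d \<and> (E * d + 1) ^ k < (d + 1) ^ k + (E * d - e + 1) ^ k"
proof -
  obtain k' where k': "k = Suc k'" using assms by (cases k) auto
  define d where "d = k * e * E ^ k' + e"
  have "e \<le> 1 * d" by (simp add: d_def)
  also have "\<dots> \<le> E * d" using assms by (intro mult_right_mono) auto
  finally have le: "e \<le> E * d" .
  have "(E * d + 1) ^ k' \<le> (E * (d + 1)) ^ k'"
    using assms by (intro power_mono) auto
  then have "k * e * (E * d + 1) ^ k' \<le> (k * e * E ^ k') * (d + 1) ^ k'"
    unfolding power_mult_distrib by (simp only: mult.assoc mult_le_mono2)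
  also have "\<dots> < (d + 1) * (d + 1) ^ k'"
    by (intro mult_strict_right_mono) (auto simp: d_def)
  finally have "k * e * (E * d + 1) ^ k' < (d + 1) ^ k" by (simp add: k')
  moreover have "(E * d + 1) ^ k \<le> (E * d + 1 - e) ^ k + k * e * (E * d + 1) ^ k'"
    using power_le_shifted_power[of e "E * d + 1" k'] le unfolding k' by simp
  moreover have "E * d + 1 - e = E * d - e + 1" using le by simp
  ultimately show ?thesis using le by (intro exI[of _ d]) simp
qed

text \<open>This is the algebraic form of the fact that the image of a \<open>(k - 1)\<close>-dimensional variety is not dense in
\<open>k\<close>-space. Look for \<open>D\<close> of degree at most \<open>d\<close> and a cofactor \<open>R\<close> with
\<open>D \<circ> \<phi> = - q * R\<close>. Comparing coefficients gives a homogeneous linear system in the coefficients of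
\<open>D\<close> and \<open>R\<close>, which for large \<open>d\<close> has more unknowns than equations. In a nontrivial solution \<open>D\<close>
cannot be zero, since \<open>q * R\<close> would then vanish with both factors nonzero.\<close>

theorem polynomial_image_of_hypersurface:
  fixes \<phi> :: "('k::finite \<Rightarrow> complex) \<Rightarrow> 'k \<Rightarrow> complex"
  assumes \<phi>: "\<And>j. polyfun (\<lambda>x. \<phi> x j)" and q: "polyfun q" "q z \<noteq> 0"
  shows "\<exists>D. polyfun D \<and> (\<exists>c. D c \<noteq> 0) \<and> (\<forall>x. q x = 0 \<longrightarrow> D (\<phi> x) = 0)"
proof -
  obtain e where e: "polydeg (\<lambda>_. e) q" using polyfun_imp_polydeg q by blast
  obtain a where a: "\<And>j. polydeg (\<lambda>_. a j) (\<lambda>x. \<phi> x j)"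
    using polyfun_imp_polydeg[OF \<phi>] by metis
  define E where "E = (\<Sum>j\<in>UNIV. a j) + 1"
  obtain d where d: "e \<le> E * d"
      "(E * d + 1) ^ CARD('k) < (d + 1) ^ CARD('k) + (E * d - e + 1) ^ CARD('k)"
    using box_counting_inequality[of "CARD('k)" E e] by (auto simp: E_def)
  define n where "n = E * d"
  \<comment> \<open>\<open>?A\<close> and \<open>?B\<close> index the coefficients of \<open>D\<close> and of the cofactor \<open>R\<close>, \<open>?C\<close> the monomials to be compared\<close>
  let ?A = "{..(\<lambda>_::'k. d)}" and ?B = "{..(\<lambda>_::'k. n - e)}" and ?C = "{..(\<lambda>_::'k. n)}"
  let ?m = "\<lambda>(x :: 'k \<Rightarrow> complex) \<alpha>. \<Prod>i\<in>UNIV. x i ^ \<alpha> i"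
  have degA: "polydeg (\<lambda>_. n) (\<lambda>x. grid_poly d \<beta> (\<phi> x))" if "\<beta> \<in> ?A" for \<beta>
  proof -
    have lin: "polydeg (\<lambda>_. a i) (\<lambda>x. \<phi> x i - of_nat l)" for i and l :: nat
      using polydeg_add[OF a polydeg_const, of i "- of_nat l"] by simp
    have "polydeg (\<lambda>_. \<Sum>i\<in>UNIV. \<Sum>l\<in>{..d} - {\<beta> i}. a i) (\<lambda>x. grid_poly d \<beta> (\<phi> x))"
      unfolding grid_poly_def by (intro polydeg_prod lin)
    moreover have "(\<Sum>i\<in>UNIV. \<Sum>l\<in>{..d} - {\<beta> i}. a i) = (\<Sum>i\<in>UNIV. a i) * d"
      using that by (simp add: le_fun_def mult.commute flip: sum_distrib_left)
    ultimately have "polydeg (\<lambda>_. (\<Sum>i\<in>UNIV. a i) * d) (\<lambda>x. grid_poly d \<beta> (\<phi> x))" by simp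
    then show ?thesis
      by (rule polydeg_mono) (auto simp: le_fun_def n_def E_def)
  qed
  have degB: "polydeg (\<lambda>_. n) (\<lambda>x. q x * grid_poly (n - e) \<gamma> x)" if "\<gamma> \<in> ?B" for \<gamma>
    using polydeg_mult[OF e polydeg_grid_poly, of \<gamma> "n - e"] that d(1)
    by (simp add: n_def)
  define F where "F s = (case s of Inl \<beta> \<Rightarrow> \<lambda>x. grid_poly d \<beta> (\<phi> x)
      | Inr \<gamma> \<Rightarrow> \<lambda>x. q x * grid_poly (n - e) \<gamma> x)" for s
  define I where "I = Inl ` ?A \<union> Inr ` ?B"
  have "polydeg (\<lambda>_. n) (F s)" if "s \<in> I" for s
    using that degA degB by (auto simp: I_def F_def)
  then obtain h where h: "\<And>s x. s \<in> I \<Longrightarrow> F s x = (\<Sum>\<alpha>\<in>?C. h s \<alpha> * ?m x \<alpha>)"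
    unfolding polydeg_def by metis
  have cardI: "card I = card ?A + card ?B"
    unfolding I_def by (subst card_Un_disjoint) (auto simp: card_image)
  have "card ?C < card I"
    using d unfolding cardI card_atMost_const_fun n_def by simp
  then obtain u where u: "\<exists>s\<in>I. u s \<noteq> 0" "\<And>\<alpha>. \<alpha> \<in> ?C \<Longrightarrow> (\<Sum>s\<in>I. h s \<alpha> * u s) = 0"
    using underdetermined_system_nontrivial[of ?C I "\<lambda>\<alpha> s. h s \<alpha>"] by (auto simp: I_def)
  have rel: "(\<Sum>s\<in>I. u s * F s x) = 0" for x
  proof -
    have "(\<Sum>s\<in>I. u s * F s x) = (\<Sum>s\<in>I. \<Sum>\<alpha>\<in>?C. h s \<alpha> * u s * ?m x \<alpha>)"
      by (intro sum.cong) (auto simp: h sum_distrib_left mult_ac)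
    also have "\<dots> = (\<Sum>\<alpha>\<in>?C. (\<Sum>s\<in>I. h s \<alpha> * u s) * ?m x \<alpha>)"
      by (subst sum.swap) (simp add: sum_distrib_right)
    also have "\<dots> = 0" using u(2) by simp
    finally show ?thesis .
  qed
  define D where "D y = (\<Sum>\<beta>\<in>?A. u (Inl \<beta>) * grid_poly d \<beta> y)" for y
  define R where "R x = (\<Sum>\<gamma>\<in>?B. u (Inr \<gamma>) * grid_poly (n - e) \<gamma> x)" for x
  have pD: "polyfun D" unfolding D_def
    by (intro polyfun_intros polyfun_grid_poly)
  have pR: "polyfun R" unfolding R_def by (intro polyfun_intros polyfun_grid_poly)
  have DR: "D (\<phi> x) = - (q x * R x)" for x
  proof -
    have "(\<Sum>s\<in>I. u s * F s x) = (\<Sum>s\<in>Inl ` ?A. u s * F s x) + (\<Sum>s\<in>Inr ` ?B. u s * F s x)"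
      unfolding I_def by (intro sum.union_disjoint) auto
    also have "\<dots> = D (\<phi> x) + q x * R x"
      by (simp add: sum.reindex F_def D_def R_def sum_distrib_left mult_ac)
    finally show ?thesis using rel[of x] by (simp add: eq_neg_iff_add_eq_0)
  qed
  have "\<exists>c. D c \<noteq> 0"
  proof (rule ccontr)
    assume D0: "\<not> (\<exists>c. D c \<noteq> 0)"
    then have "u (Inl \<beta>) = 0" if "\<beta> \<in> ?A" for \<beta>
      using grid_poly_combination_nonzero[of \<beta> d "\<lambda>\<beta>. u (Inl \<beta>)"] that
      unfolding D_def by auto
    then obtain \<gamma> where "\<gamma> \<in> ?B" "u (Inr \<gamma>) \<noteq> 0" using u(1) by (auto simp: I_def)
    then have "R (\<lambda>i. of_nat (\<gamma> i)) \<noteq> 0"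
      using grid_poly_combination_nonzero[of \<gamma> "n - e" "\<lambda>\<gamma>. u (Inr \<gamma>)"] unfolding R_def by simp
    then obtain x where "q x * R x \<noteq> 0" using polyfun_mult_nonzero[of q R z, OF q(1) pR q(2)] by blast
    then show False using DR[of x] D0 by auto
  qed
  then show ?thesis using pD DR by auto
qed

section \<open>Multiaffine systems and their strata at infinity\<close>

text \<open>A system is given by its coefficients \<open>c i S\<close>, where \<open>S\<close> stands for the monomial
\<open>\<Prod>\<^bsub>j \<in> S\<^esub> y\<^sub>j\<close> of the \<open>i\<close>-th equation. Only the sets \<open>S\<close> avoiding \<open>i\<close> enter. For \<open>T = {}\<close> the
following is the \<open>i\<close>-th equation itself. In general it is the coefficient in that equation of the product of
all \<open>y\<^sub>j\<close> with \<open>j \<in> T - {i}\<close>, that is, the equation on the stratum of \<open>(P\<^sup>1)\<^sup>m\<close> where exactly the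
coordinates in \<open>T\<close> are infinite.\<close>

definition lead_eq :: "'m::finite set \<Rightarrow> ('m \<Rightarrow> 'm set \<Rightarrow> complex) \<Rightarrow> 'm \<Rightarrow> ('m \<Rightarrow> complex) \<Rightarrow> complex" where
  "lead_eq T c i y = (\<Sum>S\<in>Pow (- T - {i}). c i ((T - {i}) \<union> S) * (\<Prod>j\<in>S. y j))"

text \<open>The Jacobian matrix of the equations \<open>lead_eq {} c\<close>, with the derivatives computed formally.\<close>

definition jac :: "('m::finite \<Rightarrow> 'm set \<Rightarrow> complex) \<Rightarrow> ('m \<Rightarrow> complex) \<Rightarrow> complex ^ 'm ^ 'm" where
  "jac c y = (\<chi> i k. if i = k then 0 else \<Sum>S\<in>Pow (- {i, k}). c i (insert k S) * (\<Prod>j\<in>S. y j))"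

text \<open>There is no zero at infinity, and every affine zero is simple.\<close>

definition nondegenerate :: "('m::finite \<Rightarrow> 'm set \<Rightarrow> complex) \<Rightarrow> bool" where
  "nondegenerate c \<longleftrightarrow> (\<forall>T y. (\<forall>i. lead_eq T c i y = 0) \<longrightarrow> T = {} \<and> det (jac c y) \<noteq> 0)"

definition sols :: "('m::finite \<Rightarrow> 'm set \<Rightarrow> complex) \<Rightarrow> (complex ^ 'm) set" where
  "sols c = {y. \<forall>i. lead_eq {} c i (($) y) = 0}"

text \<open>The \<open>i\<close>-th equation in homogeneous coordinates \<open>(a\<^sub>j : b\<^sub>j)\<close> of \<open>y\<^sub>j = a\<^sub>j / b\<^sub>j\<close>.\<close>

definition hom_eq :: "('m::finite \<Rightarrow> 'm set \<Rightarrow> complex) \<Rightarrow> 'm \<Rightarrow> ('m \<Rightarrow> complex) \<Rightarrow> ('m \<Rightarrow> complex) \<Rightarrow> complex" where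
  "hom_eq c i a b = (\<Sum>S\<in>Pow (- {i}). c i S * (\<Prod>j\<in>S. a j) * (\<Prod>j\<in>- {i} - S. b j))"

text \<open>If \<open>b\<close> vanishes exactly on \<open>T\<close>, the surviving monomials are those containing every \<open>a\<^sub>j\<close> with
\<open>j \<in> T - {i}\<close>. Up to a common factor they form the leading equation of the stratum \<open>T\<close>.\<close>

lemma hom_eq_chart:
  fixes a b :: "'m::finite \<Rightarrow> complex"
  assumes T: "T = {j. b j = 0}"
  shows "hom_eq c i a b =
    (\<Prod>j\<in>T - {i}. a j) * (\<Prod>j\<in>- T - {i}. b j) * lead_eq T c i (\<lambda>j. a j / b j)"
proof -
  let ?h = "\<lambda>S. c i S * (\<Prod>j\<in>S. a j) * (\<Prod>j\<in>- {i} - S. b j)"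
  have "hom_eq c i a b = (\<Sum>S\<in>(\<lambda>S. (T - {i}) \<union> S) ` Pow (- T - {i}). ?h S)"
    unfolding hom_eq_def
  proof (rule sum.mono_neutral_right)
    show "\<forall>S\<in>Pow (- {i}) - (\<lambda>S. (T - {i}) \<union> S) ` Pow (- T - {i}). ?h S = 0"
    proof
      fix S assume S: "S \<in> Pow (- {i}) - (\<lambda>S. (T - {i}) \<union> S) ` Pow (- T - {i})"
      have "\<not> T - {i} \<subseteq> S"
      proof
        assume "T - {i} \<subseteq> S"
        then have "S = (T - {i}) \<union> (S - T)" "S - T \<in> Pow (- T - {i})" using S by auto
        then show False using S by blast
      qed
      then obtain j where "j \<in> - {i} - S" "b j = 0" using T by auto
      then show "?h S = 0" by auto
    qed
  qed auto
  also have "\<dots> = (\<Sum>S\<in>Pow (- T - {i}). ?h ((T - {i}) \<union> S))"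
    by (subst sum.reindex) (auto simp: inj_on_def)
  also have "\<dots> = (\<Sum>S\<in>Pow (- T - {i}). (\<Prod>j\<in>T - {i}. a j) * (\<Prod>j\<in>- T - {i}. b j) *
      (c i ((T - {i}) \<union> S) * (\<Prod>j\<in>S. a j / b j)))"
  proof (rule sum.cong)
    fix S assume S: "S \<in> Pow (- T - {i})"
    then have S': "S \<subseteq> - T - {i}" by simp
    have 1: "(\<Prod>j\<in>(T - {i}) \<union> S. a j) = (\<Prod>j\<in>T - {i}. a j) * (\<Prod>j\<in>S. a j)"
      using S by (intro prod.union_disjoint) auto
    have 2: "- {i} - ((T - {i}) \<union> S) = (- T - {i}) - S" by auto
    have 3: "(\<Prod>j\<in>- T - {i}. b j) = (\<Prod>j\<in>(- T - {i}) - S. b j) * (\<Prod>j\<in>S. b j)"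
      by (rule prod.subset_diff[OF S']) simp
    have 4: "(\<Prod>j\<in>S. b j) \<noteq> 0" using S' T by auto
    show "?h ((T - {i}) \<union> S) = (\<Prod>j\<in>T - {i}. a j) * (\<Prod>j\<in>- T - {i}. b j) *
      (c i ((T - {i}) \<union> S) * (\<Prod>j\<in>S. a j / b j))"
      unfolding 1 2 3 prod_dividef using 4 by simp
  qed simp
  finally show ?thesis by (simp add: lead_eq_def sum_distrib_left)
qed

lemma nondegenerate_hom_zero_finite:
  assumes "nondegenerate c" "\<And>i. hom_eq c i a b = 0" "\<And>j. a j \<noteq> 0 \<or> b j \<noteq> 0"
  shows "b j \<noteq> 0"
proof -
  define T where "T = {j. b j = 0}"
  have "lead_eq T c i (\<lambda>j. a j / b j) = 0" for i
  proof -
    have "(\<Prod>j\<in>T - {i}. a j) \<noteq> 0" "(\<Prod>j\<in>- T - {i}. b j) \<noteq> 0"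
      using assms(3) by (auto simp: T_def)
    then show ?thesis using hom_eq_chart[OF T_def, of c i a] assms(2)[of i] by simp
  qed
  then have "T = {}" using assms(1) unfolding nondegenerate_def by blast
  then show ?thesis by (auto simp: T_def)
qed

lemma hom_eq_scaled:
  assumes "\<And>j. b j \<noteq> 0" "lead_eq {} c i y = 0"
  shows "hom_eq c i (\<lambda>j. b j * y j) b = 0"
proof -
  have "{} = {j. b j = 0}" using assms by auto
  from hom_eq_chart[OF this, of c i "\<lambda>j. b j * y j"] show ?thesis using assms by simp
qed

section \<open>The number of zeros is locally constant\<close>

definition line :: "('m \<Rightarrow> 'm set \<Rightarrow> complex) \<Rightarrow> ('m \<Rightarrow> 'm set \<Rightarrow> complex) \<Rightarrow> complex \<Rightarrow> 'm \<Rightarrow> 'm set \<Rightarrow> complex" where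
  "line c d t = (\<lambda>i S. c i S + t * (d i S - c i S))"

lemma norm_vec_le_sum: "norm (x :: complex ^ 'm::finite) \<le> (\<Sum>j\<in>UNIV. norm (x $ j))"
  unfolding norm_vec_def by (rule L2_set_le_sum) simp

text \<open>Zeros can only escape towards a zero at infinity of the limit system. Quantitatively: over the compact
set \<open>W\<close> of zeros \<open>(t, a, b)\<close> with normalised homogeneous coordinates, the function
\<open>dist t t0 + \<Prod>\<^sub>j \<bar>b\<^sub>j\<bar>\<close> could vanish only at a zero at infinity for \<open>t = t0\<close>, so it has a positive
lower bound. For \<open>t\<close> near \<open>t0\<close> this bounds every \<open>\<bar>b\<^sub>j\<bar>\<close> from below, hence \<open>\<bar>a\<^sub>j / b\<^sub>j\<bar>\<close>
from above.\<close>

lemma sols_locally_bounded: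
  fixes c d :: "'m::finite \<Rightarrow> 'm set \<Rightarrow> complex"
  assumes "nondegenerate (line c d t0)"
  shows "\<exists>e>0. \<exists>R. \<forall>t. dist t t0 < e \<longrightarrow> sols (line c d t) \<subseteq> cball 0 R"
proof -
  define W :: "(complex \<times> (complex ^ 'm) \<times> (complex ^ 'm)) set" where "W = {(t, a, b). t \<in> cball t0 1 \<and>
     (\<forall>j. (norm (a $ j))\<^sup>2 + (norm (b $ j))\<^sup>2 = 1) \<and>
     (\<forall>i. hom_eq (line c d t) i (($) a) (($) b) = 0)}"
  define \<delta> where "\<delta> = (\<lambda>(t, a :: complex ^ 'm, b :: complex ^ 'm). dist t t0 + (\<Prod>j\<in>UNIV. norm (b $ j)))"
  have le1: "norm (a $ j) \<le> 1" "norm (b $ j) \<le> 1" if "(t, a, b) \<in> W" for t a b j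
  proof -
    have "(norm (a $ j))\<^sup>2 + (norm (b $ j))\<^sup>2 = 1" using that by (auto simp: W_def)
    then have "(norm (a $ j))\<^sup>2 \<le> 1\<^sup>2" "(norm (b $ j))\<^sup>2 \<le> 1\<^sup>2"
      using zero_le_power2[of "norm (a $ j)"] zero_le_power2[of "norm (b $ j)"]
      unfolding power_one by linarith+
    then show "norm (a $ j) \<le> 1" "norm (b $ j) \<le> 1"
      using power2_le_imp_le zero_le_one by blast+
  qed
  have "closed W"
  proof -
    have "W = (cball t0 1 \<times> UNIV) \<inter>
      (\<Inter>j. {z. (norm (fst (snd z) $ j))\<^sup>2 + (norm (snd (snd z) $ j))\<^sup>2 = 1}) \<inter>
      (\<Inter>i. {z. hom_eq (line c d (fst z)) i (($) (fst (snd z))) (($) (snd (snd z))) = 0})"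
      by (auto simp: W_def)
    moreover have "closed {z :: complex \<times> (complex ^ 'm) \<times> (complex ^ 'm).
        (norm (fst (snd z) $ j))\<^sup>2 + (norm (snd (snd z) $ j))\<^sup>2 = 1}" for j
      by (intro closed_Collect_eq continuous_intros)
    moreover have "closed {z :: complex \<times> (complex ^ 'm) \<times> (complex ^ 'm).
        hom_eq (line c d (fst z)) i (($) (fst (snd z))) (($) (snd (snd z))) = 0}" for i
      unfolding hom_eq_def line_def by (intro closed_Collect_eq continuous_intros)
    ultimately show ?thesis by (auto intro!: closed_Int closed_INT closed_Times)
  qed
  moreover have "bounded W"
  proof -
    have "W \<subseteq> cball t0 1 \<times> cball 0 (real CARD('m)) \<times> cball 0 (real CARD('m))"
    proof
      fix z assume "z \<in> W"
      then obtain t a b where z: "z = (t, a, b)" and W: "(t, a, b) \<in> W" by (cases z) auto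
      have "norm a \<le> (\<Sum>j\<in>UNIV. norm (a $ j))" "norm b \<le> (\<Sum>j\<in>UNIV. norm (b $ j))"
        by (auto intro: norm_vec_le_sum)
      moreover have "(\<Sum>j\<in>UNIV. norm (a $ j)) \<le> (\<Sum>j\<in>(UNIV :: 'm set). 1)"
        "(\<Sum>j\<in>UNIV. norm (b $ j)) \<le> (\<Sum>j\<in>(UNIV :: 'm set). 1)"
        by (intro sum_mono le1[OF W])+
      ultimately show "z \<in> cball t0 1 \<times> cball 0 (real CARD('m)) \<times> cball 0 (real CARD('m))"
        using W by (auto simp: W_def z)
    qed
    then show ?thesis by (rule bounded_subset[rotated]) (intro bounded_Times bounded_cball)
  qed
  ultimately have "compact W" by (simp add: compact_eq_bounded_closed)
  have pos: "\<delta> z > 0" if "z \<in> W" for z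
  proof -
    obtain t a b where z: "z = (t, a, b)" by (cases z)
    show ?thesis
    proof (cases "t = t0")
      case True
      have "b $ j \<noteq> 0" for j
      proof (rule nondegenerate_hom_zero_finite[OF assms, where b = "($) b" and a = "($) a"])
        show "hom_eq (line c d t0) i (($) a) (($) b) = 0" for i
          using that True by (auto simp: z W_def)
        show "a $ j \<noteq> 0 \<or> b $ j \<noteq> 0" for j
        proof -
          have "(norm (a $ j))\<^sup>2 + (norm (b $ j))\<^sup>2 = 1" using that z by (auto simp: W_def)
          then show ?thesis by auto
        qed
      qed
      then show ?thesis by (simp add: z \<delta>_def prod_pos add_nonneg_pos)
    next
      case False
      then show ?thesis by (simp add: z \<delta>_def add_pos_nonneg prod_nonneg)
    qed
  qed
  have "continuous_on W \<delta>"
    unfolding \<delta>_def case_prod_unfold by (intro continuous_intros)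
  have "\<exists>e>0. \<forall>z\<in>W. e \<le> \<delta> z"
  proof (cases "W = {}")
    case False
    then obtain z where "z \<in> W" "\<forall>y\<in>W. \<delta> z \<le> \<delta> y"
      using continuous_attains_inf[OF \<open>compact W\<close> _ \<open>continuous_on W \<delta>\<close>] by blast
    then show ?thesis using pos by blast
  qed (auto intro: exI[of _ 1])
  then obtain e where e: "e > 0" "\<And>z. z \<in> W \<Longrightarrow> e \<le> \<delta> z" by blast
  have "norm y \<le> CARD('m) * (2 / e)" if t: "dist t t0 < min 1 (e / 2)" and y: "y \<in> sols (line c d t)" for t y
  proof -
    \<comment> \<open>normalised homogeneous coordinates \<open>(b\<^sub>j y\<^sub>j : b\<^sub>j)\<close> of \<open>y\<^sub>j\<close>\<close>
    define b where "b j = complex_of_real (1 / sqrt (1 + (norm (y $ j))\<^sup>2))" for j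
    have p: "1 + (norm (y $ j))\<^sup>2 > 0" for j by (simp add: add_pos_nonneg)
    have nb: "norm (b j) = 1 / sqrt (1 + (norm (y $ j))\<^sup>2)" for j
      unfolding b_def norm_of_real using p[of j] by simp
    have b0: "b j \<noteq> 0" for j using p[of j] by (auto simp: b_def)
    have "(t, (\<chi> j. b j * y $ j), (\<chi> j. b j)) \<in> W"
    proof -
      have "(norm (b j * y $ j))\<^sup>2 + (norm (b j))\<^sup>2 = 1" for j
      proof -
        have "(norm (b j))\<^sup>2 = 1 / (1 + (norm (y $ j))\<^sup>2)"
          using p[of j] by (simp add: nb power_divide)
        moreover have "(norm (b j * y $ j))\<^sup>2 + (norm (b j))\<^sup>2 = (norm (b j))\<^sup>2 * (1 + (norm (y $ j))\<^sup>2)"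
          by (simp add: norm_mult power_mult_distrib algebra_simps)
        ultimately show ?thesis using p[of j] by simp
      qed
      moreover have "hom_eq (line c d t) i (\<lambda>j. b j * y $ j) b = 0" for i
        by (rule hom_eq_scaled) (use b0 y in \<open>auto simp: sols_def\<close>)
      moreover have "(($) (\<chi> j. b j * y $ j)) = (\<lambda>j. b j * y $ j)" "(($) (\<chi> j. b j)) = b" by auto
      ultimately show ?thesis using t by (simp add: W_def dist_commute)
    qed
    note bW = this
    from e(2)[OF bW] t have prod: "e / 2 \<le> (\<Prod>j\<in>UNIV. norm (b j))" by (simp add: \<delta>_def)
    have "norm (y $ j) \<le> 2 / e" for j
    proof -
      have "(\<Prod>j\<in>UNIV. norm (b j)) = norm (b j) * (\<Prod>j\<in>UNIV - {j}. norm (b j))"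
        by (simp add: prod.remove)
      also have "\<dots> \<le> norm (b j) * 1"
        by (intro mult_left_mono prod_le_1) (use le1(2)[OF bW] in auto)
      finally have nbj: "e / 2 \<le> norm (b j)" using prod by simp
      have "norm (b j) * norm (y $ j) \<le> 1"
        using le1(1)[OF bW, of j] by (simp add: norm_mult)
      then have "e / 2 * norm (y $ j) \<le> 1"
        using mult_right_mono[OF nbj, of "norm (y $ j)"] by simp
      then show ?thesis using e(1) by (simp add: field_simps)
    qed
    then have "(\<Sum>j\<in>UNIV. norm (y $ j)) \<le> (\<Sum>j\<in>(UNIV::'m set). 2 / e)" by (intro sum_mono)
    then show ?thesis using norm_vec_le_sum[of y] by simp
  qed
  then show ?thesis using e(1)
    by (intro exI[of _ "min 1 (e / 2)"] conjI exI[of _ "CARD('m) * (2 / e)"]) auto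
qed

text \<open>The left-hand side is the derivative of \<open>lead_eq {} c i\<close> at \<open>y\<close> in direction \<open>k\<close>, as
produced by the product rule.\<close>

lemma sum_prod_derivative_eq_jac:
  fixes y k :: "'m::finite \<Rightarrow> complex"
  shows "(\<Sum>S\<in>Pow (- {i}). c i S * (\<Sum>l\<in>S. k l * (\<Prod>j\<in>S - {l}. y j)))
    = (\<Sum>l\<in>UNIV. jac c y $ i $ l * k l)"
proof -
  have "(\<Sum>S\<in>Pow (- {i}). c i S * (\<Sum>l\<in>S. k l * (\<Prod>j\<in>S - {l}. y j)))
    = (\<Sum>S\<in>Pow (- {i}). \<Sum>l\<in>{l \<in> UNIV. l \<in> S}. c i S * k l * (\<Prod>j\<in>S - {l}. y j))"
    by (simp add: sum_distrib_left mult.assoc)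
  also have "\<dots> = (\<Sum>l\<in>UNIV. \<Sum>S\<in>{S \<in> Pow (- {i}). l \<in> S}. c i S * k l * (\<Prod>j\<in>S - {l}. y j))"
    by (rule sum.swap_restrict) auto
  also have "\<dots> = (\<Sum>l\<in>UNIV. jac c y $ i $ l * k l)"
  proof (rule sum.cong)
    fix l :: 'm
    show "(\<Sum>S\<in>{S \<in> Pow (- {i}). l \<in> S}. c i S * k l * (\<Prod>j\<in>S - {l}. y j)) = jac c y $ i $ l * k l"
    proof (cases "i = l")
      case True
      then have "{S \<in> Pow (- {i}). l \<in> S} = {}" by auto
      then show ?thesis using True by (simp add: jac_def)
    next
      case False
      have "{S \<in> Pow (- {i}). l \<in> S} = insert l ` Pow (- {i, l})"
      proof (intro equalityI subsetI)
        fix S assume "S \<in> {S \<in> Pow (- {i}). l \<in> S}"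
        then have "S = insert l (S - {l})" "S - {l} \<in> Pow (- {i, l})" by auto
        then show "S \<in> insert l ` Pow (- {i, l})" by blast
      qed (use False in auto)
      moreover have "inj_on (insert l) (Pow (- {i, l}))"
      proof (rule inj_onI)
        fix A B assume "A \<in> Pow (- {i, l})" "B \<in> Pow (- {i, l})" "insert l A = insert l B"
        then show "A = B" by (metis ComplD PowD insertCI insert_ident subsetD)
      qed
      ultimately have "(\<Sum>S\<in>{S \<in> Pow (- {i}). l \<in> S}. c i S * k l * (\<Prod>j\<in>S - {l}. y j))
        = (\<Sum>S\<in>Pow (- {i, l}). c i (insert l S) * k l * (\<Prod>j\<in>insert l S - {l}. y j))"
        by (simp add: sum.reindex)
      also have "\<dots> = (\<Sum>S\<in>Pow (- {i, l}). c i (insert l S) * (\<Prod>j\<in>S. y j) * k l)"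
      proof (rule sum.cong)
        fix S assume "S \<in> Pow (- {i, l})"
        then have "insert l S - {l} = S" by auto
        then show "c i (insert l S) * k l * (\<Prod>j\<in>insert l S - {l}. y j)
          = c i (insert l S) * (\<Prod>j\<in>S. y j) * k l" by simp
      qed simp
      finally show ?thesis using False by (simp add: jac_def sum_distrib_right)
    qed
  qed simp
  finally show ?thesis .
qed

lemma has_derivative_vec_componentwise:
  fixes f :: "'a::real_normed_vector \<Rightarrow> complex ^ 'm::finite"
  assumes "\<And>i. ((\<lambda>x. f x $ i) has_derivative (\<lambda>h. f' h $ i)) (at x)"
  shows "(f has_derivative f') (at x)"
proof -
  have "((\<lambda>x. f x \<bullet> b) has_derivative (\<lambda>h. f' h \<bullet> b)) (at x)" if b: "b \<in> Basis" for b
  proof -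
    obtain i u where "b = axis i u" using b by (auto simp: Basis_vec_def)
    then show ?thesis
      using has_derivative_inner_left[OF assms[of i], of u] by (simp add: inner_axis)
  qed
  then show ?thesis by (subst has_derivative_componentwise_within) blast
qed

text \<open>The inverse function theorem, applied to \<open>(t, y) \<mapsto> (t, E\<^sub>t(y))\<close> where \<open>E\<^sub>t\<close> is the map given by the
equations of the system at \<open>t\<close>. Its derivative is block triangular with the Jacobian matrix as the
nontrivial block.\<close>

lemma simple_zero_persists:
  fixes c d :: "'m::finite \<Rightarrow> 'm set \<Rightarrow> complex"
  assumes y0: "y0 \<in> sols (line c d t0)" and det: "det (jac (line c d t0) (($) y0)) \<noteq> 0"
    and W: "open W" "y0 \<in> W"
  shows "\<exists>B e. open B \<and> y0 \<in> B \<and> B \<subseteq> W \<and> e > 0 \<and>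
    (\<forall>t. dist t t0 < e \<longrightarrow> (\<exists>!y. y \<in> B \<and> y \<in> sols (line c d t)))"
proof -
  define \<Psi> where "\<Psi> z = (fst z, \<chi> i. lead_eq {} (line c d (fst z)) i (($) (snd z)))"
    for z :: "complex \<times> (complex ^ 'm)"
  define G where "G z h = (fst h,
     \<chi> i. (\<Sum>S\<in>Pow (- {i}). line c d (fst z) i S * (\<Sum>l\<in>S. snd h $ l * (\<Prod>j\<in>S - {l}. snd z $ j))
         + fst h * (d i S - c i S) * (\<Prod>j\<in>S. snd z $ j)))" for z h :: "complex \<times> (complex ^ 'm)"
  have deriv: "(\<Psi> has_derivative G z) (at z)" for z
  proof -
    have "((\<lambda>z. \<chi> i. lead_eq {} (line c d (fst z)) i (($) (snd z))) has_derivative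
      (\<lambda>h. \<chi> i. (\<Sum>S\<in>Pow (- {i}). line c d (fst z) i S * (\<Sum>l\<in>S. snd h $ l * (\<Prod>j\<in>S - {l}. snd z $ j))
         + fst h * (d i S - c i S) * (\<Prod>j\<in>S. snd z $ j)))) (at z)"
    proof (rule has_derivative_vec_componentwise, unfold vec_lambda_beta, goal_cases)
      case (1 i)
      have comp: "((\<lambda>z. snd z $ j) has_derivative (\<lambda>h. snd h $ j)) (at z)"
        for j and z :: "complex \<times> (complex ^ 'm)"
        by (intro bounded_linear_imp_has_derivative bounded_linear_compose[OF bounded_linear_vec_nth]
            bounded_linear_snd)
      have line: "((\<lambda>z. line c d (fst z) i S) has_derivative (\<lambda>h. fst h * (d i S - c i S))) (at z)"
        for S and z :: "complex \<times> (complex ^ 'm)"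
        unfolding line_def by (auto intro!: derivative_eq_intros)
      show ?case unfolding lead_eq_def
        by (auto intro!: derivative_eq_intros line comp simp: Compl_eq_Diff_UNIV)
    qed
    then show ?thesis unfolding \<Psi>_def[abs_def] G_def[abs_def]
      by (intro has_derivative_Pair has_derivative_fst has_derivative_ident)
  qed
  then have bl: "bounded_linear (G z)" for z by (rule has_derivative_bounded_linear)
  define F where "F z = Blinfun (G z)" for z
  have F: "blinfun_apply (F z) = G z" for z
    unfolding F_def by (rule bounded_linear_Blinfun_apply[OF bl])
  have contF: "continuous_on U F" for U
    by (rule continuous_on_blinfun_componentwise, unfold F G_def line_def) (intro continuous_intros)
  let ?z0 = "(t0, y0)"
  have "inj (G ?z0)"
  proof -
    have "h = 0" if h: "G ?z0 h = 0" for h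
    proof -
      have 1: "fst h = 0" using h by (simp add: G_def prod_eq_iff)
      have "(jac (line c d t0) (($) y0) *v snd h) $ i = snd (G ?z0 h) $ i" for i
        using 1 by (simp add: G_def matrix_vector_mult_def sum_prod_derivative_eq_jac[symmetric])
      then have "jac (line c d t0) (($) y0) *v snd h = 0" by (simp add: vec_eq_iff h)
      moreover have "invertible (jac (line c d t0) (($) y0))" using det by (simp add: invertible_det_nz)
      ultimately have "snd h = 0"
        using matrix_left_invertible_ker unfolding invertible_def by blast
      then show ?thesis using 1 by (simp add: prod_eq_iff)
    qed
    then show ?thesis using bounded_linear.linear[OF bl] linear_injective_0 by blast
  qed
  then obtain g where g: "linear g" "g \<circ> G ?z0 = id"
    using linear_injective_left_inverse[OF bounded_linear.linear[OF bl]] by blast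
  have inv: "Blinfun g o\<^sub>L F ?z0 = id_blinfun"
  proof (rule blinfun_eqI)
    fix h
    have "g (G ?z0 h) = h" using g(2) by (metis comp_apply id_apply)
    then show "blinfun_apply (Blinfun g o\<^sub>L F ?z0) h = blinfun_apply id_blinfun h"
      using g(1) by (simp add: F bounded_linear_Blinfun_apply linear_conv_bounded_linear)
  qed
  have opn: "open (UNIV \<times> W)" and z0W: "?z0 \<in> UNIV \<times> W" using W by (auto intro: open_Times)
  have derF: "(\<Psi> has_derivative blinfun_apply (F z)) (at z)" for z
    using deriv by (simp add: F)
  have "\<exists>U V g. open U \<and> U \<subseteq> UNIV \<times> W \<and> ?z0 \<in> U \<and> open V \<and> \<Psi> ?z0 \<in> V \<and> homeomorphism U V \<Psi> g"
  proof (rule inverse_function_theorem[where f = \<Psi> and f' = F and U = "UNIV \<times> W" and ?x0.0 = ?z0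
      and invf = "Blinfun g", OF opn _ contF z0W inv])
    show "\<exists>U V g. open U \<and> U \<subseteq> UNIV \<times> W \<and> ?z0 \<in> U \<and> open V \<and> \<Psi> ?z0 \<in> V \<and> homeomorphism U V \<Psi> g"
      if "open U'" "U' \<subseteq> UNIV \<times> W" "?z0 \<in> U'" "open V" "\<Psi> ?z0 \<in> V" "homeomorphism U' V \<Psi> g" for U' V g
      using that by (intro exI[of _ U'] exI[of _ V] exI[of _ g]) simp
  qed (rule derF)
  then obtain U V g where U: "open U" "U \<subseteq> UNIV \<times> W" "?z0 \<in> U" and V: "open V" "\<Psi> ?z0 \<in> V"
    and hom: "homeomorphism U V \<Psi> g"
    by (elim exE conjE)
  obtain A B where AB: "open A" "open B" "t0 \<in> A" "y0 \<in> B" "A \<times> B \<subseteq> U"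
  proof -
    from open_prod_elim[OF U(1,3)] obtain A B where "open A" "open B" "?z0 \<in> A \<times> B" "A \<times> B \<subseteq> U" .
    then show ?thesis using that[of A B] by simp
  qed
  have \<Psi>0: "\<Psi> (t, y) = (t, 0) \<longleftrightarrow> y \<in> sols (line c d t)" for t y
    by (simp add: \<Psi>_def sols_def vec_eq_iff)
  have z0: "\<Psi> ?z0 = (t0, 0)" using y0 by (simp add: \<Psi>0)
  have "continuous_on V g" using hom by (simp add: homeomorphism_def)
  then have "open (V \<inter> g -` (A \<times> B))"
    using V(1) AB(1,2) by (intro continuous_open_preimage open_Times)
  moreover have "(t0, 0) \<in> V \<inter> g -` (A \<times> B)"
    using V(2) AB(3,4) homeomorphism_apply1[OF hom U(3)] by (simp add: z0)
  ultimately obtain A' B' where A': "open A'" "t0 \<in> A'" "0 \<in> B'" "A' \<times> B' \<subseteq> V \<inter> g -` (A \<times> B)"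
    by (metis open_prod_elim mem_Times_iff fst_conv snd_conv)
  obtain e where e: "e > 0" "ball t0 e \<subseteq> A \<inter> A'"
    using AB(1,3) A'(1,2) by (meson IntI open_Int openE)
  have "\<exists>!y. y \<in> B \<and> y \<in> sols (line c d t)" if t: "dist t t0 < e" for t
  proof -
    have tA: "t \<in> A" "t \<in> A'" using e t by (auto simp: dist_commute subset_iff)
    have tV: "(t, 0) \<in> V" "g (t, 0) \<in> A \<times> B" using A'(3,4) tA by auto
    obtain s y where sy: "g (t, 0) = (s, y)" by fastforce
    have "\<Psi> (s, y) = (t, 0)" using homeomorphism_apply2[OF hom tV(1)] sy by simp
    then have "y \<in> sols (line c d t)" using \<Psi>0 by (metis \<Psi>_def fst_conv)
    moreover have "y \<in> B" using tV sy by simp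
    moreover have "y' = y''" if "y' \<in> B" "y' \<in> sols (line c d t)" "y'' \<in> B" "y'' \<in> sols (line c d t)" for y' y''
    proof -
      have "(t, y') \<in> U" "(t, y'') \<in> U" using AB(5) tA that by auto
      moreover have "\<Psi> (t, y') = \<Psi> (t, y'')" using that \<Psi>0 by metis
      ultimately show ?thesis using homeomorphism_apply1[OF hom] by (metis Pair_inject)
    qed
    ultimately show ?thesis by blast
  qed
  moreover have "B \<subseteq> W" using AB(3,5) U(2) by blast
  ultimately show ?thesis using AB(2,4) e(1) by blast
qed

lemma closed_solution_graph:
  "closed {z. snd z \<in> sols (line c d (fst z))}"
proof -
  have "{z. snd z \<in> sols (line c d (fst z))}
    = (\<Inter>i. {z. lead_eq {} (line c d (fst z)) i (($) (snd z)) = 0})"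
    by (auto simp: sols_def)
  moreover have "closed {z :: complex \<times> (complex ^ 'a). lead_eq {} (line c d (fst z)) i (($) (snd z)) = 0}" for i
    unfolding lead_eq_def line_def by (intro closed_Collect_eq continuous_intros)
  ultimately show ?thesis by (auto intro!: closed_INT)
qed

text \<open>The zeros at \<open>t0\<close> are isolated and form a compact set, so there are finitely many. Each of them continues to
exactly one zero inside a small neighbourhood. The zeros for \<open>t\<close> near \<open>t0\<close> remain in a fixed ball, and by
compactness none of them lies outside these neighbourhoods.\<close>

lemma sols_locally_constant:
  fixes c d :: "'m::finite \<Rightarrow> 'm set \<Rightarrow> complex"
  assumes good: "nondegenerate (line c d t0)"
  shows "finite (sols (line c d t0)) \<and>
    (\<exists>e>0. \<forall>t. dist t t0 < e \<longrightarrow> card (sols (line c d t)) = card (sols (line c d t0)))"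
proof -
  let ?Z = "\<lambda>t. sols (line c d t)"
  obtain e0 R where e0: "e0 > 0" and R: "\<And>t. dist t t0 < e0 \<Longrightarrow> ?Z t \<subseteq> cball 0 R"
    using sols_locally_bounded[OF good] by blast
  have det: "det (jac (line c d t0) (($) y)) \<noteq> 0" if "y \<in> ?Z t0" for y
    using good that unfolding nondegenerate_def sols_def by blast
  have "closed (?Z t0)"
  proof -
    have "?Z t0 = Pair t0 -` {z. snd z \<in> sols (line c d (fst z))}" by auto
    moreover have "closed (Pair t0 -` {z. snd z \<in> sols (line c d (fst z))})"
      by (rule closed_vimage[OF closed_solution_graph]) (intro continuous_intros)
    ultimately show ?thesis by simp
  qed
  then have cpt: "compact (?Z t0)"
    using R[of t0] e0 by (auto simp: compact_eq_bounded_closed intro: bounded_subset[OF bounded_cball])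
  have fin: "finite (?Z t0)"
  proof -
    have "\<exists>B. open B \<and> y \<in> B \<and> (\<exists>!y. y \<in> B \<and> y \<in> ?Z t0)" if "y \<in> ?Z t0" for y
      using simple_zero_persists[OF that det[OF that], of UNIV] dist_self by (metis UNIV_I open_UNIV)
    then obtain B where B: "\<And>y. y \<in> ?Z t0 \<Longrightarrow> open (B y) \<and> y \<in> B y \<and> (\<exists>!x. x \<in> B y \<and> x \<in> ?Z t0)"
      by metis
    obtain Y where Y: "Y \<subseteq> ?Z t0" "finite Y" "?Z t0 \<subseteq> (\<Union>y\<in>Y. B y)"
      using compactE_image[OF cpt, of "?Z t0" B] B by blast
    have "?Z t0 \<subseteq> Y"
    proof
      fix x assume x: "x \<in> ?Z t0"
      then obtain y where "y \<in> Y" "x \<in> B y" using Y by blast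
      then have "x = y" using B[of y] Y x by blast
      then show "x \<in> Y" using \<open>y \<in> Y\<close> by simp
    qed
    then show ?thesis using Y finite_subset by blast
  qed
  obtain r where r: "r > 0" "\<And>x y. x \<in> ?Z t0 \<Longrightarrow> y \<in> ?Z t0 \<Longrightarrow> x \<noteq> y \<Longrightarrow> ball x r \<inter> ball y r = {}"
  proof -
    have "\<exists>\<delta>>0. \<forall>x\<in>?Z t0. \<forall>y\<in>?Z t0. x \<noteq> y \<longrightarrow> \<delta> \<le> dist x y"
    proof (cases "\<exists>x\<in>?Z t0. \<exists>y\<in>?Z t0. x \<noteq> y")
      case True
      define P where "P = (\<lambda>p. dist (fst p) (snd p)) ` {p \<in> ?Z t0 \<times> ?Z t0. fst p \<noteq> snd p}"
      have "finite P" unfolding P_def using fin by simp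
      moreover have "P \<noteq> {}" unfolding P_def using True by force
      moreover have "\<forall>r\<in>P. r > 0" unfolding P_def by auto
      ultimately have "Min P > 0" by (simp add: Min_gr_iff)
      moreover have "Min P \<le> dist x y" if "x \<in> ?Z t0" "y \<in> ?Z t0" "x \<noteq> y" for x y
        using \<open>finite P\<close> that unfolding P_def by (intro Min_le) force+
      ultimately show ?thesis by blast
    qed (auto intro: exI[of _ 1])
    then obtain \<delta> where \<delta>: "\<delta> > 0" "\<And>x y. x \<in> ?Z t0 \<Longrightarrow> y \<in> ?Z t0 \<Longrightarrow> x \<noteq> y \<Longrightarrow> \<delta> \<le> dist x y"
      by blast
    have "ball x (\<delta>/2) \<inter> ball y (\<delta>/2) = {}" if "x \<in> ?Z t0" "y \<in> ?Z t0" "x \<noteq> y" for x y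
      using \<delta>(2)[OF that] dist_triangle_half_l[of x _ \<delta> y]
      by (auto simp: disjoint_iff dist_commute)
    then show ?thesis using that[of "\<delta>/2"] \<delta>(1) by auto
  qed
  define isolates where "isolates y B e \<longleftrightarrow> open B \<and> y \<in> B \<and> B \<subseteq> ball y r \<and> e > 0 \<and>
    (\<forall>t. dist t t0 < e \<longrightarrow> (\<exists>!x. x \<in> B \<and> x \<in> ?Z t))" for y B e
  have "\<exists>B e. isolates y B e" if "y \<in> ?Z t0" for y
    unfolding isolates_def
    by (rule simple_zero_persists[OF that det[OF that]]) (use r(1) in auto)
  then obtain B e where iso: "\<And>y. y \<in> ?Z t0 \<Longrightarrow> isolates y (B y) (e y)" by metis
  have B: "open (B y) \<and> y \<in> B y \<and> B y \<subseteq> ball y r" and e: "e y > 0"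
    and ex1: "dist t t0 < e y \<Longrightarrow> \<exists>!x. x \<in> B y \<and> x \<in> ?Z t" if "y \<in> ?Z t0" for y t
    using iso[OF that] unfolding isolates_def by auto
  \<comment> \<open>the zeros for \<open>t\<close> near \<open>t0\<close> that lie outside all the chosen neighbourhoods\<close>
  define K where "K = {z. snd z \<in> ?Z (fst z)} \<inter> (cball t0 (e0/2) \<times> (cball 0 R - (\<Union>y\<in>?Z t0. B y)))"
  have "compact K" unfolding K_def
    using B by (intro closed_Int_compact closed_solution_graph compact_Times compact_cball compact_diff) auto
  then have cl: "closed (fst ` K)"
    by (intro compact_imp_closed compact_continuous_image continuous_intros)
  have "t0 \<notin> fst ` K" using B by (auto simp: K_def)
  then obtain e1 where e1: "e1 > 0" "ball t0 e1 \<subseteq> - fst ` K"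
    using cl by (metis ComplI open_Compl openE)
  obtain e2 where e2: "e2 > 0" "\<And>y. y \<in> ?Z t0 \<Longrightarrow> e2 \<le> e y"
  proof (cases "?Z t0 = {}")
    case False
    then show ?thesis using that[of "Min (e ` ?Z t0)"] fin e by auto
  qed (use that[of 1] in auto)
  have "card (?Z t) = card (?Z t0)" if t: "dist t t0 < min (e0/2) (min e1 e2)" for t
  proof -
    have cover: "x \<in> (\<Union>y\<in>?Z t0. B y)" if x: "x \<in> ?Z t" for x
    proof (rule ccontr)
      assume "x \<notin> (\<Union>y\<in>?Z t0. B y)"
      then have "(t, x) \<in> K" using x t R[of t] e0 by (auto simp: K_def dist_commute)
      then have "t \<in> fst ` K" by force
      then show False using e1(2) t by (auto simp: dist_commute subset_iff)
    qed
    have ex1': "\<exists>!x. x \<in> B y \<and> x \<in> ?Z t" if "y \<in> ?Z t0" for y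
      using ex1[OF that, of t] e2(2)[OF that] t by linarith
    define f where "f y = (THE x. x \<in> B y \<and> x \<in> ?Z t)" for y
    have f: "f y \<in> B y" "f y \<in> ?Z t" if "y \<in> ?Z t0" for y
      using theI'[OF ex1'[OF that]] by (auto simp: f_def)
    have "bij_betw f (?Z t0) (?Z t)"
      unfolding bij_betw_def
    proof (intro conjI inj_onI equalityI subsetI)
      fix x y assume xy: "x \<in> ?Z t0" "y \<in> ?Z t0" "f x = f y"
      then have "f x \<in> ball x r \<inter> ball y r" using f B by (metis IntI subsetD)
      then show "x = y" using r(2) xy by blast
    next
      fix x assume x: "x \<in> ?Z t"
      then obtain y where y: "y \<in> ?Z t0" "x \<in> B y" using cover by blast
      then have "f y = x" using ex1' f x by blast
      then show "x \<in> f ` ?Z t0" using y by blast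
    qed (use f in auto)
    then show ?thesis by (simp add: bij_betw_same_card)
  qed
  moreover have "min (e0/2) (min e1 e2) > 0" using e0 e1(1) e2(1) by simp
  ultimately show ?thesis using fin by blast
qed

theorem card_sols_eq_along_line:
  fixes c d :: "'m::finite \<Rightarrow> 'm set \<Rightarrow> complex"
  assumes "finite X" "\<And>t. t \<notin> X \<Longrightarrow> nondegenerate (line c d t)" "nondegenerate c" "nondegenerate d"
  shows "card (sols c) = card (sols d)"
proof -
  let ?A = "- (X - {0, 1})"
  have ends: "line c d 0 = c" "line c d 1 = d" by (auto simp: line_def)
  have "connected ?A"
    using assms(1) by (intro path_connected_imp_connected path_connected_complement_countable)
      (auto intro: countable_finite)
  moreover have "\<forall>t\<in>?A. eventually (\<lambda>s. card (sols (line c d t)) = card (sols (line c d s))) (at t within ?A)"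
  proof
    fix t assume "t \<in> ?A"
    then have "nondegenerate (line c d t)" using assms ends by auto
    from sols_locally_constant[OF this] obtain e where "e > 0" "\<forall>s. dist s t < e \<longrightarrow> card (sols (line c d s)) = card (sols (line c d t))" by blast
    then show "eventually (\<lambda>s. card (sols (line c d t)) = card (sols (line c d s))) (at t within ?A)"
      unfolding eventually_at by (intro exI[of _ e] conjI ballI impI) (simp_all only: simp_thms)
  qed
  ultimately have "card (sols (line c d 0)) = card (sols (line c d 1))"
    by (intro connected_local_const[of ?A 0 1 "\<lambda>t. card (sols (line c d t))"]) auto
  then show ?thesis by (simp add: ends)
qed

section \<open>A system with one zero for each derangement\<close>

lemma det_nonzero_if_kernel_trivial:
  fixes A :: "complex ^ 'm ^ 'm::finite"
  assumes "\<And>v. (\<And>i. (\<Sum>k\<in>UNIV. A $ i $ k * v k) = 0) \<Longrightarrow> v = (\<lambda>_. 0)"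
  shows "det A \<noteq> 0"
proof -
  have "x = 0" if "A *v x = 0" for x
  proof -
    have "(\<Sum>k\<in>UNIV. A $ i $ k * x $ k) = 0" for i
      using that by (simp add: matrix_vector_mult_def vec_eq_iff)
    then have "($) x = (\<lambda>_. 0)" by (rule assms)
    then show ?thesis by (simp add: vec_eq_iff fun_eq_iff)
  qed
  then obtain B where "B ** A = mat 1" using matrix_left_invertible_ker by blast
  then have "invertible A" unfolding invertible_def using matrix_left_right_inverse by blast
  then show ?thesis by (simp add: invertible_det_nz)
qed

text \<open>The coefficients of the expanded products \<open>\<Prod>\<^bsub>j \<noteq> i\<^esub> (y\<^sub>j - \<alpha> i)\<close>.\<close>

definition product_system :: "('m::finite \<Rightarrow> complex) \<Rightarrow> 'm \<Rightarrow> 'm set \<Rightarrow> complex" where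
  "product_system \<alpha> i S = (\<Prod>j\<in>- {i} - S. - \<alpha> i)"

lemma lead_eq_product_system:
  "lead_eq T (product_system \<alpha>) i y = (\<Prod>j\<in>- T - {i}. y j - \<alpha> i)"
proof -
  have "(\<Prod>j\<in>- T - {i}. y j - \<alpha> i) = (\<Prod>j\<in>- T - {i}. y j + (- \<alpha> i))" by simp
  also have "\<dots> = (\<Sum>S\<in>Pow (- T - {i}). (\<Prod>j\<in>S. y j) * (\<Prod>j\<in>(- T - {i}) - S. - \<alpha> i))"
    by (rule prod_add) simp
  also have "\<dots> = lead_eq T (product_system \<alpha>) i y"
    unfolding lead_eq_def
  proof (rule sum.cong)
    fix S assume "S \<in> Pow (- T - {i})"
    have "(- T - {i}) - S = - {i} - ((T - {i}) \<union> S)" by auto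
    then show "(\<Prod>j\<in>S. y j) * (\<Prod>j\<in>(- T - {i}) - S. - \<alpha> i)
      = product_system \<alpha> i ((T - {i}) \<union> S) * (\<Prod>j\<in>S. y j)"
      by (simp add: product_system_def)
  qed simp
  finally show ?thesis by simp
qed

lemma jac_product_system:
  assumes "i \<noteq> k"
  shows "jac (product_system \<alpha>) y $ i $ k = (\<Prod>j\<in>- {i, k}. y j - \<alpha> i)"
proof -
  have "(\<Prod>j\<in>- {i, k}. y j - \<alpha> i) = (\<Prod>j\<in>- {i, k}. y j + (- \<alpha> i))" by simp
  also have "\<dots> = (\<Sum>S\<in>Pow (- {i, k}). (\<Prod>j\<in>S. y j) * (\<Prod>j\<in>- {i, k} - S. - \<alpha> i))"
    by (rule prod_add) simp
  also have "\<dots> = jac (product_system \<alpha>) y $ i $ k"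
    unfolding jac_def vec_lambda_beta if_not_P[OF assms]
  proof (rule sum.cong)
    fix S assume "S \<in> Pow (- {i, k})"
    have "- {i, k} - S = - {i} - insert k S" by auto
    then show "(\<Prod>j\<in>S. y j) * (\<Prod>j\<in>- {i, k} - S. - \<alpha> i)
      = product_system \<alpha> i (insert k S) * (\<Prod>j\<in>S. y j)"
      by (simp add: product_system_def)
  qed simp
  finally show ?thesis by simp
qed

text \<open>In each equation some factor vanishes, and one coordinate can serve only one equation because the
\<open>\<alpha> i\<close> are distinct. As there are as many equations as coordinates, every coordinate is used and
none is infinite.\<close>

lemma product_system_zero_matching:
  fixes y :: "'m::finite \<Rightarrow> complex"
  assumes "inj \<alpha>" and zero: "\<And>i. lead_eq T (product_system \<alpha>) i y = 0"
  obtains \<sigma> where "bij \<sigma>" "\<And>i. \<sigma> i \<notin> T" "\<And>i. \<sigma> i \<noteq> i" "\<And>i. y (\<sigma> i) = \<alpha> i"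
proof -
  have "\<exists>j. j \<notin> T \<and> j \<noteq> i \<and> y j = \<alpha> i" for i
    using zero[of i] by (auto simp: lead_eq_product_system)
  then obtain \<sigma> where \<sigma>: "\<And>i. \<sigma> i \<notin> T \<and> \<sigma> i \<noteq> i \<and> y (\<sigma> i) = \<alpha> i" by metis
  then have "inj \<sigma>" using \<open>inj \<alpha>\<close> by (metis injD injI)
  then have "bij \<sigma>" by (simp add: bij_def finite_UNIV_inj_surj)
  then show ?thesis using \<sigma> that by blast
qed

text \<open>At a zero with matching \<open>\<sigma>\<close>, each equation has exactly one vanishing factor, so row \<open>i\<close> of the
Jacobian matrix has its only nonzero entry in column \<open>\<sigma> i\<close>.\<close>

lemma nondegenerate_product_system:
  assumes "inj (\<alpha> :: 'm::finite \<Rightarrow> complex)"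
  shows "nondegenerate (product_system \<alpha>)"
  unfolding nondegenerate_def
proof (intro allI impI)
  fix T and y :: "'m \<Rightarrow> complex"
  assume "\<forall>i. lead_eq T (product_system \<alpha>) i y = 0"
  then obtain \<sigma> where \<sigma>: "bij \<sigma>" "\<And>i. \<sigma> i \<notin> T" "\<And>i. \<sigma> i \<noteq> i" "\<And>i. y (\<sigma> i) = \<alpha> i"
    using product_system_zero_matching[OF assms] by blast
  have "T = {}" using \<sigma>(1,2) by (metis bij_pointE equals0I)
  moreover have "det (jac (product_system \<alpha>) y) \<noteq> 0"
  proof (rule det_nonzero_if_kernel_trivial)
    fix v assume v: "\<And>i. (\<Sum>k\<in>UNIV. jac (product_system \<alpha>) y $ i $ k * v k) = 0"
    have "v (\<sigma> i) = 0" for i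
    proof -
      have other: "jac (product_system \<alpha>) y $ i $ k = 0" if "k \<noteq> \<sigma> i" for k
      proof (cases "i = k")
        case False
        have "\<sigma> i \<in> - {i, k}" using that \<sigma>(3) by auto
        then show ?thesis using \<sigma>(4) by (auto simp: jac_product_system[OF False])
      qed (simp add: jac_def)
      have "(\<Sum>k\<in>UNIV. jac (product_system \<alpha>) y $ i $ k * v k)
        = (\<Sum>k\<in>{\<sigma> i}. jac (product_system \<alpha>) y $ i $ k * v k)"
        by (rule sum.mono_neutral_right) (auto simp: other)
      then have "jac (product_system \<alpha>) y $ i $ \<sigma> i * v (\<sigma> i) = 0" using v[of i] by simp
      moreover have "jac (product_system \<alpha>) y $ i $ \<sigma> i \<noteq> 0"
      proof -
        have "y j \<noteq> \<alpha> i" if "j \<noteq> \<sigma> i" for j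
        proof -
          obtain l where "j = \<sigma> l" using \<sigma>(1) by (metis bij_pointE)
          then show ?thesis using that \<sigma>(4) assms by (metis injD)
        qed
        then show ?thesis using jac_product_system[of i "\<sigma> i"] \<sigma>(3)[of i] by auto
      qed
      ultimately show ?thesis by simp
    qed
    then show "v = (\<lambda>_. 0)" using \<sigma>(1) by (metis bij_pointE ext)
  qed
  ultimately show "T = {} \<and> det (jac (product_system \<alpha>) y) \<noteq> 0" by blast
qed

lemma card_sols_product_system:
  assumes "inj (\<alpha> :: 'm::finite \<Rightarrow> complex)"
  shows "card (sols (product_system \<alpha>)) = card (derangements (UNIV :: 'm set))"
proof -
  let ?f = "\<lambda>\<pi> :: 'm \<Rightarrow> 'm. \<chi> j. \<alpha> (\<pi> j)"
  have "bij_betw ?f (derangements UNIV) (sols (product_system \<alpha>))"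
    unfolding bij_betw_def
  proof (intro conjI inj_onI equalityI subsetI)
    fix \<pi> \<rho> assume "?f \<pi> = ?f \<rho>"
    then show "\<pi> = \<rho>" using assms by (auto simp: vec_eq_iff inj_def fun_eq_iff)
  next
    fix y assume "y \<in> ?f ` derangements UNIV"
    then obtain \<pi> where \<pi>: "\<pi> permutes UNIV" "\<And>a. \<pi> a \<noteq> a" "y = ?f \<pi>" by (auto simp: derangements_def)
    have "lead_eq {} (product_system \<alpha>) i (($) y) = 0" for i
    proof -
      obtain j where "\<pi> j = i" using \<pi>(1) by (metis permutes_univ)
      then have "j \<in> - {} - {i}" "y $ j - \<alpha> i = 0" using \<pi>(2)[of j] by (auto simp: \<pi>(3))
      then show ?thesis unfolding lead_eq_product_system by (intro prod_zero bexI[of _ j]) simp_all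
    qed
    then show "y \<in> sols (product_system \<alpha>)" by (simp add: sols_def)
  next
    fix y assume "y \<in> sols (product_system \<alpha>)"
    then have "lead_eq {} (product_system \<alpha>) i (($) y) = 0" for i by (simp add: sols_def)
    from product_system_zero_matching[OF assms this]
    obtain \<sigma> where \<sigma>: "bij \<sigma>" "\<And>i. \<sigma> i \<noteq> i" "\<And>i. y $ \<sigma> i = \<alpha> i" by metis
    have \<sigma>': "\<sigma> (inv \<sigma> j) = j" for j using \<sigma>(1) by (simp add: bij_is_surj surj_f_inv_f)
    have "inv \<sigma> permutes UNIV" using \<sigma>(1) by (intro permutes_inv) (simp add: permutes_def bij_iff)
    moreover have "inv \<sigma> a \<noteq> a" for a using \<sigma>' \<sigma>(2) by metis
    moreover have "y = ?f (inv \<sigma>)" by (simp add: vec_eq_iff flip: \<sigma>(3)) (simp add: \<sigma>')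
    ultimately show "y \<in> ?f ` derangements UNIV" by (auto simp: derangements_def)
  qed
  then show ?thesis by (simp add: bij_betw_same_card)
qed

section \<open>Degenerate systems lie in a hypersurface\<close>

lemma polyfun_lead_eq:
  assumes "\<And>S. polyfun (\<lambda>x. C x i S)" "\<And>j. polyfun (\<lambda>x. Y x j)"
  shows "polyfun (\<lambda>x. lead_eq T (C x) i (Y x))"
  unfolding lead_eq_def by (intro polyfun_intros assms)

lemma polyfun_det_jac:
  assumes "\<And>i S. polyfun (\<lambda>x. C x i S)" "\<And>j. polyfun (\<lambda>x. Y x j)"
  shows "polyfun (\<lambda>x. det (jac (C x) (Y x)))"
proof -
  have "polyfun (\<lambda>x. jac (C x) (Y x) $ i $ k)" for i k
  proof (cases "i = k")
    case True
    then show ?thesis by (simp add: jac_def polyfun.const)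
  next
    case False
    then show ?thesis by (simp add: jac_def) (intro polyfun_intros assms)
  qed
  then show ?thesis unfolding det_def by (intro polyfun_intros)
qed

lemma lead_eq_split_const:
  "lead_eq T c i y = c i (T - {i}) +
    (\<Sum>S\<in>Pow (- T - {i}) - {{}}. c i ((T - {i}) \<union> S) * (\<Prod>j\<in>S. y j))"
  unfolding lead_eq_def by (subst sum.remove[of _ "{}"]) auto

text \<open>The constant coefficient of the leading equation enters it additively. Replacing that coefficient therefore
changes the value by the difference, which makes it possible to solve the equation for it.\<close>

lemma lead_eq_const_change:
  assumes "\<And>S. S \<subseteq> - T - {i} \<Longrightarrow> S \<noteq> {} \<Longrightarrow> c' i ((T - {i}) \<union> S) = c i ((T - {i}) \<union> S)"
    and "\<And>j. j \<notin> T \<Longrightarrow> y' j = y j"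
  shows "lead_eq T c' i y' - c' i (T - {i}) = lead_eq T c i y - c i (T - {i})"
proof -
  have "(\<Sum>S\<in>Pow (- T - {i}) - {{}}. c' i ((T - {i}) \<union> S) * (\<Prod>j\<in>S. y' j))
    = (\<Sum>S\<in>Pow (- T - {i}) - {{}}. c i ((T - {i}) \<union> S) * (\<Prod>j\<in>S. y j))"
  proof (rule sum.cong)
    fix S assume S: "S \<in> Pow (- T - {i}) - {{}}"
    then have "(\<Prod>j\<in>S. y' j) = (\<Prod>j\<in>S. y j)" by (intro prod.cong assms(2)) auto
    then show "c' i ((T - {i}) \<union> S) * (\<Prod>j\<in>S. y' j) = c i ((T - {i}) \<union> S) * (\<Prod>j\<in>S. y j)"
      using assms(1)[of S] S by simp
  qed simp
  then show ?thesis unfolding lead_eq_split_const[of T c'] lead_eq_split_const[of T c] by simp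
qed

lemma jac_cong:
  assumes "\<And>i k S. i \<noteq> k \<Longrightarrow> S \<subseteq> - {i, k} \<Longrightarrow> c' i (insert k S) = c i (insert k S)"
  shows "jac c' y = jac c y"
  unfolding jac_def vec_eq_iff vec_lambda_beta
  by (auto intro!: sum.cong simp: assms)

lemma jac_diag: "jac c y $ i $ i = 0"
  by (simp add: jac_def)

lemma jac_at_zero: "i \<noteq> k \<Longrightarrow> jac c (\<lambda>_. 0) $ i $ k = c i {k}"
proof -
  assume "i \<noteq> k"
  then have "jac c (\<lambda>_. 0) $ i $ k = (\<Sum>S\<in>Pow (- {i, k}). c i (insert k S) * (\<Prod>j\<in>S. 0))"
    by (simp add: jac_def)
  also have "\<dots> = (\<Sum>S\<in>{{}}. c i (insert k S) * (\<Prod>j\<in>S. 0))"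
    by (rule sum.mono_neutral_right) (auto intro: finite_subset)
  finally show ?thesis by simp
qed

text \<open>The matrix has zeros on the diagonal and ones elsewhere. A kernel vector has all entries equal to
their sum \<open>s\<close>, so \<open>s = m * s\<close> with \<open>m \<ge> 2\<close>.\<close>

lemma det_jac_all_ones_nonzero:
  fixes c :: "'m::finite \<Rightarrow> 'm set \<Rightarrow> complex"
  assumes "2 \<le> CARD('m)" and "\<And>i k. i \<noteq> k \<Longrightarrow> c i {k} = 1"
  shows "det (jac c (\<lambda>_. 0)) \<noteq> 0"
proof (rule det_nonzero_if_kernel_trivial)
  fix v assume v: "\<And>i. (\<Sum>k\<in>UNIV. jac c (\<lambda>_. 0) $ i $ k * v k) = 0"
  define s where "s = (\<Sum>k\<in>UNIV. v k)"
  have vs: "v i = s" for i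
  proof -
    have "(\<Sum>k\<in>UNIV. jac c (\<lambda>_. 0) $ i $ k * v k) = (\<Sum>k\<in>UNIV - {i}. v k)"
      by (subst sum.remove[of _ i]) (auto simp: jac_diag jac_at_zero assms(2) intro!: sum.cong)
    also have "\<dots> = s - v i" by (simp add: s_def sum_diff1)
    finally show ?thesis using v[of i] by simp
  qed
  have "s = of_nat CARD('m) * s" using s_def unfolding vs by simp
  then have "of_nat (CARD('m) - 1) * s = 0" using assms(1) by (simp add: of_nat_diff algebra_simps)
  then have "s = 0" using assms(1) by simp
  then show "v = (\<lambda>_. 0)" using vs by auto
qed

text \<open>There are finitely many strata \<open>T\<close>, so it suffices to find a polynomial for each of them and to take
their product.\<close>

lemma generically_nondegenerate:
  fixes \<Gamma> :: "('k \<Rightarrow> complex) \<Rightarrow> 'm::finite \<Rightarrow> 'm set \<Rightarrow> complex"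
  assumes "\<And>T. \<exists>D. polyfun D \<and> (\<exists>c. D c \<noteq> 0) \<and>
    (\<forall>c y. (\<forall>i. lead_eq T (\<Gamma> c) i y = 0) \<longrightarrow> (T = {} \<longrightarrow> det (jac (\<Gamma> c) y) = 0) \<longrightarrow> D c = 0)"
  shows "\<exists>D. polyfun D \<and> (\<exists>c. D c \<noteq> 0) \<and> (\<forall>c. D c \<noteq> 0 \<longrightarrow> nondegenerate (\<Gamma> c))"
proof -
  obtain D where D: "\<And>T. polyfun (D T)" "\<And>T. \<exists>c. D T c \<noteq> 0"
    "\<And>T c y. (\<And>i. lead_eq T (\<Gamma> c) i y = 0) \<Longrightarrow> (T = {} \<Longrightarrow> det (jac (\<Gamma> c) y) = 0) \<Longrightarrow> D T c = 0"
    using assms by metis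
  let ?D = "\<lambda>c. \<Prod>T\<in>UNIV. D T c"
  have "polyfun ?D" by (rule polyfun_prod) (rule D(1))
  moreover have "\<exists>c. ?D c \<noteq> 0" by (rule polyfun_prod_nonzero) (use D(1,2) in auto)
  moreover have "nondegenerate (\<Gamma> c)" if "?D c \<noteq> 0" for c
    unfolding nondegenerate_def
  proof (intro allI impI)
    fix T y assume "\<forall>i. lead_eq T (\<Gamma> c) i y = 0"
    moreover have "D T c \<noteq> 0" using that by simp
    ultimately show "T = {} \<and> det (jac (\<Gamma> c) y) \<noteq> 0" using D(3)[of T c y] by blast
  qed
  ultimately show ?thesis by blast
qed

text \<open>On the stratum \<open>T\<close>, each of the \<open>m\<close> leading equations can be solved for its constant coefficient
\<open>c (i, T - {i})\<close>. The positions of these \<open>m\<close> coefficients are thereby free to store the zero: for \<open>i \<notin> T\<close> the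
position holds the affine coordinate \<open>y i\<close>, for \<open>i \<in> T\<close> it holds \<open>0\<close>. A degenerate system with
a bad zero thus becomes a point \<open>x\<close> of the coefficient space, from which \<open>\<phi>\<close> recovers the system. The
point lies on the hypersurface \<open>q = 0\<close>, where \<open>q\<close> is the Jacobian determinant if \<open>T = {}\<close> and one of the
positions holding \<open>0\<close> otherwise.\<close>

theorem generic_system_nondegenerate:
  assumes "2 \<le> CARD('m::finite)"
  shows "\<exists>D :: ('m \<times> 'm set \<Rightarrow> complex) \<Rightarrow> complex.
    polyfun D \<and> (\<exists>c. D c \<noteq> 0) \<and> (\<forall>c. D c \<noteq> 0 \<longrightarrow> nondegenerate (curry c))"
proof (rule generically_nondegenerate)
  fix T :: "'m set"
  define Y where "Y x j = x (j, T - {j})" for x :: "'m \<times> 'm set \<Rightarrow> complex" and j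
  define \<phi> where "\<phi> x = (\<lambda>(i, S). if S = T - {i} then x (i, S) - lead_eq T (curry x) i (Y x) else x (i, S))"
    for x :: "'m \<times> 'm set \<Rightarrow> complex"
  define q where "q x = (if T = {} then det (jac (curry x) (Y x)) else x (SOME i. i \<in> T, T - {SOME i. i \<in> T}))"
    for x :: "'m \<times> 'm set \<Rightarrow> complex"
  have pY: "polyfun (\<lambda>x. Y x j)" for j unfolding Y_def by (rule polyfun.var)
  have pC: "polyfun (\<lambda>x :: 'm \<times> 'm set \<Rightarrow> complex. curry x i S)" for i S
    by (simp add: polyfun.var)
  have p\<phi>: "polyfun (\<lambda>x. \<phi> x k)" for k
  proof (cases k)
    case (Pair i S)
    have "polyfun (\<lambda>x :: 'm \<times> 'm set \<Rightarrow> complex. x (i, S) + - lead_eq T (curry x) i (Y x))"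
      by (intro polyfun_intros polyfun_lead_eq pC pY)
    then show ?thesis by (cases "S = T - {i}") (simp_all add: Pair \<phi>_def polyfun.var)
  qed
  have pq: "polyfun q"
  proof (cases "T = {}")
    case True
    then have "q = (\<lambda>x. det (jac (curry x) (Y x)))" by (simp add: q_def[abs_def])
    then show ?thesis by (simp only:) (intro polyfun_det_jac pC pY)
  qed (simp add: q_def[abs_def] polyfun.var)
  have "\<exists>z. q z \<noteq> 0"
  proof (cases "T = {}")
    case True
    \<comment> \<open>here \<open>Y z = 0\<close>, and all linear coefficients are \<open>1\<close>\<close>
    define z where "z = (\<lambda>(i :: 'm, S :: 'm set). if S = {} then 0 else 1 :: complex)"
    have "Y z = (\<lambda>_. 0)" by (auto simp: Y_def z_def True)
    then have "q z \<noteq> 0"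
      using det_jac_all_ones_nonzero[of "curry z", OF assms] by (simp add: q_def True z_def)
    then show ?thesis by blast
  qed (auto simp: q_def intro: exI[of _ "\<lambda>_. 1"])
  then obtain z where "q z \<noteq> 0" ..
  from polynomial_image_of_hypersurface[of \<phi>, OF p\<phi> pq this]
  obtain D where D: "polyfun D" "\<exists>c. D c \<noteq> 0" "\<And>x. q x = 0 \<Longrightarrow> D (\<phi> x) = 0" by blast
  have "D c = 0" if zero: "\<forall>i. lead_eq T (curry c) i y = 0"
    and deg: "T = {} \<longrightarrow> det (jac (curry c) y) = 0" for c y
  proof -
    define x where "x = (\<lambda>(i, S). if S = T - {i} then (if i \<in> T then 0 else y i) else c (i, S))"
    have Yx: "Y x j = (if j \<in> T then 0 else y j)" for j by (simp add: Y_def x_def)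
    have "\<phi> x (i, S) = c (i, S)" for i S
    proof (cases "S = T - {i}")
      case True
      have "lead_eq T (curry x) i (Y x) - curry x i (T - {i}) = lead_eq T (curry c) i y - curry c i (T - {i})"
      proof (rule lead_eq_const_change)
        fix S assume "S \<subseteq> - T - {i}" "S \<noteq> {}"
        then have "(T - {i}) \<union> S \<noteq> T - {i}" by auto
        then show "curry x i ((T - {i}) \<union> S) = curry c i ((T - {i}) \<union> S)" by (simp add: x_def)
      qed (simp add: Yx)
      then show ?thesis using zero True by (simp add: \<phi>_def) (metis add_diff_cancel diff_add_cancel minus_diff_eq diff_0)
    qed (simp add: \<phi>_def x_def)
    then have "\<phi> x = c" by auto
    moreover have "q x = 0"
    proof (cases "T = {}")
      case True
      have "jac (curry x) y = jac (curry c) y" by (rule jac_cong) (simp add: x_def True)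
      moreover have "Y x = y" using Yx True by auto
      ultimately show ?thesis using deg True by (simp add: q_def)
    next
      case False
      then have "(SOME i. i \<in> T) \<in> T" by (simp add: some_in_eq)
      then show ?thesis using False by (simp add: q_def x_def)
    qed
    ultimately show ?thesis using D(3) by metis
  qed
  then show "\<exists>D. polyfun D \<and> (\<exists>c. D c \<noteq> 0) \<and>
    (\<forall>c y. (\<forall>i. lead_eq T (curry c) i y = 0) \<longrightarrow> (T = {} \<longrightarrow> det (jac (curry c) y) = 0) \<longrightarrow> D c = 0)"
    using D(1,2) by blast
qed

text \<open>The partial derivatives of the multiaffine polynomial with coefficients \<open>C\<close>.\<close>

definition gradient_system :: "('m set \<Rightarrow> complex) \<Rightarrow> 'm \<Rightarrow> 'm set \<Rightarrow> complex" where
  "gradient_system C i S = C (insert i S)"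

text \<open>The equations now share coefficients. On the stratum \<open>T\<close>, the equation of \<open>i \<notin> T\<close> has the constant
coefficient \<open>C (insert i T)\<close>, while for all \<open>i \<in> T\<close> the leading equations coincide and have the
constant coefficient \<open>C T\<close>. For \<open>T \<noteq> {}\<close> these are one more equation than there are affine coordinates,
which suffices: the position of \<open>C (insert i T)\<close> stores \<open>y i\<close>, and that of \<open>C T\<close> stores \<open>0\<close>.
The coefficients \<open>C (insert i T)\<close> also occur in the equation for \<open>C T\<close>, so they are recovered
first, by \<open>\<phi>0\<close>.\<close>

theorem generic_gradient_system_nondegenerate:
  assumes "2 \<le> CARD('m::finite)"
  shows "\<exists>D :: ('m set \<Rightarrow> complex) \<Rightarrow> complex.
    polyfun D \<and> (\<exists>C. D C \<noteq> 0) \<and> (\<forall>C. D C \<noteq> 0 \<longrightarrow> nondegenerate (gradient_system C))"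
proof (rule generically_nondegenerate)
  fix T :: "'m set"
  define i0 where "i0 = (SOME i. i \<in> T)"
  have i0: "i0 \<in> T" if "T \<noteq> {}" using that by (simp add: i0_def some_in_eq)
  define slot where "slot U \<longleftrightarrow> (\<exists>i. i \<notin> T \<and> U = insert i T)" for U
  \<comment> \<open>recovers \<open>i\<close> from \<open>insert i T\<close>\<close>
  define ix where "ix U = the_elem (U - T)" for U :: "'m set"
  have ix: "ix (insert i T) = i" if "i \<notin> T" for i
  proof -
    have "insert i T - T = {i}" using that by auto
    then show ?thesis by (simp add: ix_def)
  qed
  have slotT: "\<not> slot T" by (auto simp: slot_def)
  define Y where "Y x j = x (insert j T)" for x :: "'m set \<Rightarrow> complex" and j
  define \<phi>0 where "\<phi>0 x U = (if slot U then x U - lead_eq T (gradient_system x) (ix U) (Y x) else x U)"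
    for x :: "'m set \<Rightarrow> complex" and U
  define \<phi> where "\<phi> x U = (if T \<noteq> {} \<and> U = T
      then \<phi>0 x U - lead_eq T (gradient_system (\<phi>0 x)) i0 (Y x) else \<phi>0 x U)"
    for x :: "'m set \<Rightarrow> complex" and U
  define q where "q x = (if T = {} then det (jac (gradient_system x) (Y x)) else x T)"
    for x :: "'m set \<Rightarrow> complex"
  have pY: "polyfun (\<lambda>x. Y x j)" for j unfolding Y_def by (rule polyfun.var)
  have pC: "polyfun (\<lambda>x :: 'm set \<Rightarrow> complex. gradient_system x i S)" for i S
    by (simp add: gradient_system_def polyfun.var)
  have p\<phi>0: "polyfun (\<lambda>x. \<phi>0 x U)" for U
  proof -
    have "polyfun (\<lambda>x :: 'm set \<Rightarrow> complex. x U + - lead_eq T (gradient_system x) (ix U) (Y x))"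
      by (intro polyfun_intros polyfun_lead_eq pC pY)
    then show ?thesis by (cases "slot U") (simp_all add: \<phi>0_def polyfun.var)
  qed
  have pC0: "polyfun (\<lambda>x. gradient_system (\<phi>0 x) i S)" for i S
    by (simp add: gradient_system_def p\<phi>0)
  have p\<phi>: "polyfun (\<lambda>x. \<phi> x U)" for U
  proof -
    have "polyfun (\<lambda>x. \<phi>0 x U + - lead_eq T (gradient_system (\<phi>0 x)) i0 (Y x))"
      by (intro polyfun_intros polyfun_lead_eq pC0 pY p\<phi>0)
    then show ?thesis by (cases "T \<noteq> {} \<and> U = T") (simp_all add: \<phi>_def p\<phi>0 del: de_Morgan_conj)
  qed
  have pq: "polyfun q"
  proof (cases "T = {}")
    case True
    then have "q = (\<lambda>x. det (jac (gradient_system x) (Y x)))" by (simp add: q_def[abs_def])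
    then show ?thesis by (simp only:) (intro polyfun_det_jac pC pY)
  qed (simp add: q_def[abs_def] polyfun.var)
  have "\<exists>z. q z \<noteq> 0"
  proof (cases "T = {}")
    case True
    \<comment> \<open>the polynomial \<open>\<Sum>\<^bsub>i < k\<^esub> y\<^sub>i y\<^sub>k\<close>, whose Hessian matrix has zeros on the diagonal and ones elsewhere\<close>
    define z where "z U = (if card U = 2 then 1 else 0 :: complex)" for U :: "'m set"
    have "Y z = (\<lambda>_. 0)" by (auto simp: Y_def z_def True)
    moreover have "gradient_system z i {k} = 1" if "i \<noteq> k" for i k
      using that by (simp add: gradient_system_def z_def)
    ultimately have "q z \<noteq> 0"
      using det_jac_all_ones_nonzero[of "gradient_system z", OF assms] by (simp add: q_def True)
    then show ?thesis by blast
  qed (auto simp: q_def intro: exI[of _ "\<lambda>_. 1"])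
  then obtain z where "q z \<noteq> 0" ..
  from polynomial_image_of_hypersurface[of \<phi>, OF p\<phi> pq this]
  obtain D where D: "polyfun D" "\<exists>c. D c \<noteq> 0" "\<And>x. q x = 0 \<Longrightarrow> D (\<phi> x) = 0" by blast
  have "D C = 0" if zero: "\<forall>i. lead_eq T (gradient_system C) i y = 0"
    and deg: "T = {} \<longrightarrow> det (jac (gradient_system C) y) = 0" for C y
  proof -
    define x where "x U = (if slot U then y (ix U) else if T \<noteq> {} \<and> U = T then 0 else C U)" for U
    have Yx: "Y x j = y j" if "j \<notin> T" for j
      using that ix by (auto simp: Y_def x_def slot_def)
    have x_above: "x (insert i (T \<union> S)) = C (insert i (T \<union> S))"
      if i: "i \<notin> T" and S: "S \<subseteq> - T - {i}" "S \<noteq> {}" for i S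
    proof -
      obtain s where s: "s \<in> S" "s \<notin> T" "s \<noteq> i" using S by auto
      have "\<not> slot (insert i (T \<union> S))"
      proof
        assume "slot (insert i (T \<union> S))"
        then obtain k where "insert i (T \<union> S) = insert k T" by (auto simp: slot_def)
        then have "i = k" "s = k" using i s by auto
        then show False using s by simp
      qed
      moreover have "insert i (T \<union> S) \<noteq> T" using i by auto
      ultimately show ?thesis by (simp add: x_def)
    qed
    have \<phi>0: "\<phi>0 x U = (if T \<noteq> {} \<and> U = T then 0 else C U)" for U
    proof (cases "slot U")
      case True
      then obtain i where i: "i \<notin> T" "U = insert i T" by (auto simp: slot_def)
      have "lead_eq T (gradient_system x) i (Y x) - gradient_system x i (T - {i})
        = lead_eq T (gradient_system C) i y - gradient_system C i (T - {i})"
      proof (rule lead_eq_const_change)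
        fix S assume "S \<subseteq> - T - {i}" "S \<noteq> {}"
        then show "gradient_system x i ((T - {i}) \<union> S) = gradient_system C i ((T - {i}) \<union> S)"
          using x_above[OF i(1)] i(1) by (simp add: gradient_system_def)
      qed (rule Yx)
      then have "x U - lead_eq T (gradient_system x) i (Y x) = C U"
        using zero i by (simp add: gradient_system_def) (metis minus_diff_eq minus_minus)
      moreover have "U \<noteq> T" using i by auto
      ultimately show ?thesis using True i ix[of i] by (simp add: \<phi>0_def)
    qed (simp add: \<phi>0_def x_def)
    have "\<phi> x U = C U" for U
    proof (cases "T \<noteq> {} \<and> U = T")
      case True
      then have i: "i0 \<in> T" "insert i0 (T - {i0}) = T" using i0 by auto
      have "lead_eq T (gradient_system (\<phi>0 x)) i0 (Y x) - gradient_system (\<phi>0 x) i0 (T - {i0})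
        = lead_eq T (gradient_system C) i0 y - gradient_system C i0 (T - {i0})"
      proof (rule lead_eq_const_change)
        fix S assume "S \<subseteq> - T - {i0}" "S \<noteq> {}"
        then have "insert i0 ((T - {i0}) \<union> S) \<noteq> T" by auto
        then show "gradient_system (\<phi>0 x) i0 ((T - {i0}) \<union> S) = gradient_system C i0 ((T - {i0}) \<union> S)"
          by (simp add: gradient_system_def \<phi>0)
      qed (rule Yx)
      then show ?thesis using True i zero by (simp add: gradient_system_def \<phi>_def \<phi>0)
    next
      case False
      then show ?thesis by (auto simp: \<phi>_def \<phi>0)
    qed
    then have "\<phi> x = C" by auto
    moreover have "q x = 0"
    proof (cases "T = {}")
      case True
      have "jac (gradient_system x) y = jac (gradient_system C) y"
        by (rule jac_cong) (auto simp: gradient_system_def x_def True slot_def doubleton_eq_iff)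
      moreover have "Y x = y" using Yx True by auto
      ultimately show ?thesis using deg True by (simp add: q_def)
    next
      case False
      then show ?thesis using slotT by (simp add: q_def x_def)
    qed
    ultimately show ?thesis using D(3) by metis
  qed
  then show "\<exists>D. polyfun D \<and> (\<exists>c. D c \<noteq> 0) \<and> (\<forall>c y. (\<forall>i. lead_eq T (gradient_system c) i y = 0) \<longrightarrow>
      (T = {} \<longrightarrow> det (jac (gradient_system c) y) = 0) \<longrightarrow> D c = 0)"
    using D(1,2) by blast
qed

section \<open>Counting the zeros of a nondegenerate system\<close>

lemma inj_complex_exists: "\<exists>\<alpha> :: 'm::finite \<Rightarrow> complex. inj \<alpha>"
proof -
  obtain h :: "'m \<Rightarrow> nat" where "inj_on h UNIV" using finite_imp_inj_to_nat_seg[of "UNIV :: 'm set"] by auto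
  then have "inj (\<lambda>i. complex_of_nat (h i))" by (auto simp: inj_def)
  then show ?thesis by blast
qed

text \<open>Every nondegenerate system is joined by a line to one and the same system \<open>curry m\<close> at which the polynomial
\<open>D\<close> does not vanish. On that line \<open>D\<close> has finitely many zeros, so the number of zeros of the system agrees
with that of \<open>curry m\<close>. The product system shows what this number is.\<close>

theorem card_sols_nondegenerate:
  fixes c :: "'m::finite \<Rightarrow> 'm set \<Rightarrow> complex"
  assumes card: "2 \<le> CARD('m)" and good: "nondegenerate c"
  shows "finite (sols c) \<and> card (sols c) = card (derangements (UNIV :: 'm set))"
proof -
  obtain D :: "('m \<times> 'm set \<Rightarrow> complex) \<Rightarrow> complex" and m
    where D: "polyfun D" "D m \<noteq> 0" "\<And>c. D c \<noteq> 0 \<Longrightarrow> nondegenerate (curry c)"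
    using generic_system_nondegenerate[OF card] by blast
  have eq: "card (sols b) = card (sols (curry m))" if b: "nondegenerate b" for b :: "'m \<Rightarrow> 'm set \<Rightarrow> complex"
  proof (rule card_sols_eq_along_line)
    let ?z = "\<lambda>t k. case_prod b k + t * (m k - case_prod b k)"
    show "finite {t. D (?z t) = 0}" using polyfun_finite_zeros_on_line[of D m] D(1,2) .
    show "nondegenerate (line b (curry m) t)" if "t \<notin> {t. D (?z t) = 0}" for t
    proof -
      have "curry (?z t) = line b (curry m) t" by (simp add: curry_def line_def)
      moreover have "nondegenerate (curry (?z t))" using that D(3)[of "?z t"] by blast
      ultimately show ?thesis by simp
    qed
  qed (use b D in auto)
  obtain \<alpha> :: "'m \<Rightarrow> complex" where "inj \<alpha>" using inj_complex_exists by blast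
  then have "card (sols c) = card (derangements (UNIV :: 'm set))"
    using eq[OF good] eq[OF nondegenerate_product_system] card_sols_product_system by metis
  moreover have "line c c 0 = c" by (simp add: line_def)
  then have "finite (sols c)" using sols_locally_constant[of c c 0] good by simp
  ultimately show ?thesis by blast
qed

section \<open>Evaluation of multiaffine polynomials\<close>

lemma mpoly_eval_superset:
  assumes "finite A" "Poly_Mapping.keys p \<subseteq> A"
  shows "mpoly_eval p x = (\<Sum>\<alpha>\<in>A. Poly_Mapping.lookup p \<alpha> *
    (\<Prod>i\<in>Poly_Mapping.keys \<alpha>. x i ^ Poly_Mapping.lookup \<alpha> i))"
  unfolding mpoly_eval_def using assms
  by (intro sum.mono_neutral_left) (auto simp: in_keys_iff)

lemma mpoly_eval_add: "mpoly_eval (p + q) x = mpoly_eval p x + mpoly_eval q x"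
proof -
  let ?A = "Poly_Mapping.keys p \<union> Poly_Mapping.keys q"
  have "mpoly_eval r x = (\<Sum>\<alpha>\<in>?A. Poly_Mapping.lookup r \<alpha> *
    (\<Prod>i\<in>Poly_Mapping.keys \<alpha>. x i ^ Poly_Mapping.lookup \<alpha> i))" if "Poly_Mapping.keys r \<subseteq> ?A" for r
    using that by (intro mpoly_eval_superset) auto
  then show ?thesis
    using Poly_Mapping.keys_add[of p q] by (simp add: lookup_add distrib_right sum.distrib)
qed

lemma mpoly_eval_sum: "mpoly_eval (\<Sum>a\<in>A. p a) x = (\<Sum>a\<in>A. mpoly_eval (p a) x)"
  by (induction A rule: infinite_finite_induct) (simp_all add: mpoly_eval_add, simp_all add: mpoly_eval_def)

lemma mpoly_eval_single:
  "mpoly_eval (Poly_Mapping.single \<alpha> a) x = a * (\<Prod>i\<in>Poly_Mapping.keys \<alpha>. x i ^ Poly_Mapping.lookup \<alpha> i)"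
  by (subst mpoly_eval_superset[of "{\<alpha>}"]) auto

lemma polyfun_imp_mpoly:
  fixes p :: "('k::finite \<Rightarrow> complex) \<Rightarrow> complex"
  assumes "polyfun p"
  shows "\<exists>P. \<forall>x. mpoly_eval P x = p x"
proof -
  obtain n where "polydeg (\<lambda>_. n) p" using polyfun_imp_polydeg[OF assms] by blast
  then obtain d where d: "\<And>x. p x = (\<Sum>\<alpha>\<in>{..\<lambda>_. n}. d \<alpha> * (\<Prod>i\<in>UNIV. x i ^ \<alpha> i))"
    unfolding polydeg_def by blast
  have lookup: "Poly_Mapping.lookup (Abs_poly_mapping \<alpha>) = \<alpha>" for \<alpha> :: "'k \<Rightarrow> nat"
    by (rule lookup_Abs_poly_mapping) simp
  have mon: "(\<Prod>i\<in>Poly_Mapping.keys (Abs_poly_mapping \<alpha>). x i ^ Poly_Mapping.lookup (Abs_poly_mapping \<alpha>) i)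
    = (\<Prod>i\<in>UNIV. x i ^ \<alpha> i)" for \<alpha> and x :: "'k \<Rightarrow> complex"
    by (intro prod.mono_neutral_cong_left) (auto simp: lookup in_keys_iff)
  have "mpoly_eval (\<Sum>\<alpha>\<in>{..\<lambda>_. n}. Poly_Mapping.single (Abs_poly_mapping \<alpha>) (d \<alpha>)) x = p x" for x
    by (simp add: mpoly_eval_sum mpoly_eval_single mon d del: lookup_Abs_poly_mapping)
  then show ?thesis by blast
qed

lemma lookup_multiaffine_monomial:
  "Poly_Mapping.lookup (multiaffine_monomial S) i = (if i \<in> S then 1 else 0)"
  by (simp add: multiaffine_monomial_def lookup_sum lookup_single when_def)

lemma keys_multiaffine_monomial: "Poly_Mapping.keys (multiaffine_monomial S) = S"
  by (auto simp: in_keys_iff lookup_multiaffine_monomial split: if_splits)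

lemma inj_multiaffine_monomial: "inj multiaffine_monomial"
  by (metis injI keys_multiaffine_monomial)

lemma multiaffine_keys:
  assumes "multiaffine p"
  shows "Poly_Mapping.keys p \<subseteq> range multiaffine_monomial"
proof
  fix \<alpha> assume "\<alpha> \<in> Poly_Mapping.keys p"
  then have le: "Poly_Mapping.lookup \<alpha> i \<le> 1" for i using assms by (simp add: multiaffine_def)
  have "\<alpha> = multiaffine_monomial (Poly_Mapping.keys \<alpha>)"
  proof (rule poly_mapping_eqI)
    fix i
    show "Poly_Mapping.lookup \<alpha> i = Poly_Mapping.lookup (multiaffine_monomial (Poly_Mapping.keys \<alpha>)) i"
      using le[of i] by (auto simp: lookup_multiaffine_monomial in_keys_iff)
  qed
  then show "\<alpha> \<in> range multiaffine_monomial" by blast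
qed

lemma prod_multiaffine_monomial:
  "(\<Prod>i\<in>Poly_Mapping.keys (multiaffine_monomial S). x i ^ Poly_Mapping.lookup (multiaffine_monomial S) i)
    = (\<Prod>i\<in>S. x i)"
  by (simp add: keys_multiaffine_monomial lookup_multiaffine_monomial)

lemma mpoly_eval_multiaffine:
  assumes "multiaffine p"
  shows "mpoly_eval p x = (\<Sum>S\<in>UNIV. Poly_Mapping.lookup p (multiaffine_monomial S) * (\<Prod>i\<in>S. x i))"
  by (subst mpoly_eval_superset[OF _ multiaffine_keys[OF assms]])
    (simp_all add: sum.reindex inj_multiaffine_monomial prod_multiaffine_monomial)

lemma mpoly_eval_partial_multiaffine:
  fixes p :: "('n::finite, complex) mpoly"
  assumes "multiaffine p"
  shows "mpoly_eval (mpoly_partial i p) x =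
    (\<Sum>S\<in>Pow (- {i}). Poly_Mapping.lookup p (multiaffine_monomial (insert i S)) * (\<Prod>j\<in>S. x j))"
proof -
  let ?m = "multiaffine_monomial :: 'n set \<Rightarrow> _"
  let ?h = "\<lambda>\<alpha>. of_nat (Poly_Mapping.lookup \<alpha> i) * Poly_Mapping.lookup p \<alpha> *
    (\<Prod>j\<in>Poly_Mapping.keys (\<alpha> - Poly_Mapping.single i 1). x j ^ Poly_Mapping.lookup (\<alpha> - Poly_Mapping.single i 1) j)"
  have "mpoly_eval (mpoly_partial i p) x = (\<Sum>\<alpha>\<in>Poly_Mapping.keys p. ?h \<alpha>)"
    by (simp add: mpoly_partial_def mpoly_eval_sum mpoly_eval_single)
  also have "\<dots> = (\<Sum>\<alpha>\<in>range ?m. ?h \<alpha>)"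
    by (intro sum.mono_neutral_left multiaffine_keys assms) (auto simp: in_keys_iff)
  also have "\<dots> = (\<Sum>S\<in>UNIV. ?h (?m S))"
    by (subst sum.reindex[OF inj_multiaffine_monomial]) simp
  also have "\<dots> = (\<Sum>S\<in>insert i ` Pow (- {i}). ?h (?m S))"
  proof (rule sum.mono_neutral_right)
    show "\<forall>S\<in>UNIV - insert i ` Pow (- {i}). ?h (?m S) = 0"
    proof
      fix S assume S: "S \<in> UNIV - insert i ` Pow (- {i})"
      have "i \<notin> S"
      proof
        assume "i \<in> S"
        then have "S = insert i (S - {i})" "S - {i} \<in> Pow (- {i})" by auto
        then show False using S by blast
      qed
      then show "?h (?m S) = 0" by (simp add: lookup_multiaffine_monomial)
    qed
  qed auto
  also have "\<dots> = (\<Sum>S\<in>Pow (- {i}). ?h (?m (insert i S)))"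
  proof (subst sum.reindex)
    show "inj_on (insert i) (Pow (- {i}))"
      by (rule inj_onI) (metis ComplD PowD insert_ident singletonI subsetD)
  qed simp
  also have "\<dots> = (\<Sum>S\<in>Pow (- {i}). Poly_Mapping.lookup p (?m (insert i S)) * (\<Prod>j\<in>S. x j))"
  proof (rule sum.cong)
    fix S assume "S \<in> Pow (- {i})"
    then have "?m (insert i S) - Poly_Mapping.single i 1 = ?m S"
      by (intro poly_mapping_eqI) (auto simp: lookup_minus lookup_multiaffine_monomial lookup_single when_def)
    then show "?h (?m (insert i S)) = Poly_Mapping.lookup p (?m (insert i S)) * (\<Prod>j\<in>S. x j)"
      by (simp add: prod_multiaffine_monomial) (simp add: lookup_multiaffine_monomial)
  qed simp
  finally show ?thesis .
qed

section \<open>The Lagrange system as a gradient system\<close>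

lemma lookup_complexify: "Poly_Mapping.lookup (complexify p) \<alpha> = complex_of_real (Poly_Mapping.lookup p \<alpha>)"
  by (simp add: complexify_def Poly_Mapping.map.rep_eq when_def)

lemma lookup_lagrangian:
  "Poly_Mapping.lookup (complexify g - Poly_Mapping.single 0 \<mu> * complexify f) \<alpha> =
    complex_of_real (Poly_Mapping.lookup g \<alpha>) - \<mu> * complex_of_real (Poly_Mapping.lookup f \<alpha>)"
  by (simp add: lookup_minus lookup_complexify Poly_Mapping.map.rep_eq when_def
      flip: mult_map_scale_conv_mult)

lemma multiaffine_if_coeffs_vanish:
  assumes "\<And>\<alpha> i. 1 < Poly_Mapping.lookup \<alpha> i \<Longrightarrow> Poly_Mapping.lookup p \<alpha> = 0"
  shows "multiaffine p"
  unfolding multiaffine_def using assms by (metis in_keys_iff linorder_not_le)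

lemma multiaffine_coeff_vanishes:
  "multiaffine p \<Longrightarrow> 1 < Poly_Mapping.lookup \<alpha> i \<Longrightarrow> Poly_Mapping.lookup p \<alpha> = 0"
  unfolding multiaffine_def by (metis in_keys_iff linorder_not_le)

text \<open>The coefficients of \<open>g - \<mu> f\<close> as a multiaffine polynomial in the variables \<open>x\<close> and \<open>\<mu>\<close>, the latter
being indexed by \<open>None\<close>.\<close>

definition lagrangian_coeffs :: "('n set + 'n set \<Rightarrow> complex) \<Rightarrow> 'n option set \<Rightarrow> complex" where
  "lagrangian_coeffs a S = (if None \<in> S then - a (Inl (Some -` S)) else a (Inr (Some -` S)))"

text \<open>The derivative in the direction of the multiplier is \<open>- f\<close>, so the constraint is part of the gradient system.\<close>

lemma lead_eq_multiplier:
  fixes a :: "'n::finite set + 'n set \<Rightarrow> complex"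
  shows "lead_eq {} (gradient_system (lagrangian_coeffs a)) None y =
    - (\<Sum>S\<in>UNIV. a (Inl S) * (\<Prod>i\<in>S. y (Some i)))"
proof -
  have "Pow (- {None :: 'n option}) = range ((`) Some)"
  proof (intro equalityI subsetI)
    fix S :: "'n option set" assume "S \<in> Pow (- {None})"
    then have "S = Some ` (Some -` S)" by (auto simp: image_iff) (metis not_None_eq)
    then show "S \<in> range ((`) Some)" by blast
  qed auto
  then have "lead_eq {} (gradient_system (lagrangian_coeffs a)) None y =
    (\<Sum>S\<in>range ((`) Some). lagrangian_coeffs a (insert None S) * (\<Prod>j\<in>S. y j))"
    by (simp add: lead_eq_def gradient_system_def Compl_eq_Diff_UNIV)
  also have "\<dots> = (\<Sum>S\<in>UNIV. lagrangian_coeffs a (insert None (Some ` S)) * (\<Prod>j\<in>Some ` S. y j))"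
    by (subst sum.reindex) (auto simp: inj_def inj_image_eq_iff)
  also have "\<dots> = (\<Sum>S\<in>UNIV. - (a (Inl S) * (\<Prod>i\<in>S. y (Some i))))"
  proof (rule sum.cong)
    fix S :: "'n set"
    have "Some -` insert None (Some ` S) = S" by auto
    then show "lagrangian_coeffs a (insert None (Some ` S)) * (\<Prod>j\<in>Some ` S. y j)
      = - (a (Inl S) * (\<Prod>i\<in>S. y (Some i)))"
      by (simp add: lagrangian_coeffs_def prod.reindex)
  qed simp
  finally show ?thesis by (simp add: sum_negf)
qed

lemma lead_eq_variable:
  fixes a :: "'n::finite set + 'n set \<Rightarrow> complex"
  shows "lead_eq {} (gradient_system (lagrangian_coeffs a)) (Some i) y =
    (\<Sum>S\<in>Pow (- {i}). (a (Inr (insert i S)) - y None * a (Inl (insert i S))) * (\<Prod>j\<in>S. y (Some j)))"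
proof -
  let ?h = "\<lambda>S. lagrangian_coeffs a (insert (Some i) S) * (\<Prod>j\<in>S. y j)"
  let ?A = "(`) Some ` Pow (- {i})" and ?B = "(\<lambda>S. insert None (Some ` S)) ` Pow (- {i})"
  have split: "Pow (- {Some i}) = ?A \<union> ?B"
  proof (intro equalityI subsetI)
    fix S :: "'n option set" assume S: "S \<in> Pow (- {Some i})"
    have *: "Some -` S \<in> Pow (- {i})" using S by auto
    show "S \<in> ?A \<union> ?B"
    proof (cases "None \<in> S")
      case True
      then have "S = insert None (Some ` (Some -` S))" by (auto simp: image_iff)
      then show ?thesis by (intro UnI2 image_eqI[of _ _ "Some -` S"] *)
    next
      case False
      then have "S = Some ` (Some -` S)" by (auto simp: image_iff) (metis not_None_eq)
      then show ?thesis by (intro UnI1 image_eqI[of _ _ "Some -` S"] *)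
    qed
  qed auto
  have "lead_eq {} (gradient_system (lagrangian_coeffs a)) (Some i) y = (\<Sum>S\<in>Pow (- {Some i}). ?h S)"
    by (simp add: lead_eq_def gradient_system_def Compl_eq_Diff_UNIV)
  also have "\<dots> = (\<Sum>S\<in>?A. ?h S) + (\<Sum>S\<in>?B. ?h S)"
    unfolding split by (rule sum.union_disjoint) auto
  also have "(\<Sum>S\<in>?A. ?h S) = (\<Sum>S\<in>Pow (- {i}). ?h (Some ` S))"
    by (subst sum.reindex) (auto simp: inj_on_def inj_image_eq_iff)
  also have "\<dots> = (\<Sum>S\<in>Pow (- {i}). a (Inr (insert i S)) * (\<Prod>j\<in>S. y (Some j)))"
  proof (rule sum.cong)
    fix S :: "'n set"
    have "Some -` insert (Some i) (Some ` S) = insert i S" by auto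
    then show "?h (Some ` S) = a (Inr (insert i S)) * (\<Prod>j\<in>S. y (Some j))"
      by (auto simp: lagrangian_coeffs_def prod.reindex)
  qed simp
  also have "(\<Sum>S\<in>?B. ?h S) = (\<Sum>S\<in>Pow (- {i}). ?h (insert None (Some ` S)))"
  proof (subst sum.reindex)
    show "inj_on (\<lambda>S. insert None (Some ` S)) (Pow (- {i}))"
    proof (rule inj_onI)
      fix S S' :: "'n set" assume "insert None (Some ` S) = insert None (Some ` S')"
      then have "Some -` insert None (Some ` S) = Some -` insert None (Some ` S')" by simp
      moreover have "Some -` insert None (Some ` X) = X" for X :: "'n set" by auto
      ultimately show "S = S'" by simp
    qed
  qed simp
  also have "\<dots> = (\<Sum>S\<in>Pow (- {i}). - (y None * a (Inl (insert i S)) * (\<Prod>j\<in>S. y (Some j))))"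
  proof (rule sum.cong)
    fix S :: "'n set"
    have "Some -` insert (Some i) (insert None (Some ` S)) = insert i S" by auto
    then show "?h (insert None (Some ` S)) = - (y None * a (Inl (insert i S)) * (\<Prod>j\<in>S. y (Some j)))"
      by (auto simp: lagrangian_coeffs_def prod.reindex)
  qed simp
  finally show ?thesis by (simp add: left_diff_distrib sum_subtractf sum_negf)
qed

lemma lagrange_solutions_bij_betw_sols:
  fixes f g :: "('n::finite, real) mpoly"
  assumes f: "multiaffine f" and g: "multiaffine g"
  shows "bij_betw (\<lambda>(x, \<mu>). \<chi> j. case j of None \<Rightarrow> \<mu> | Some i \<Rightarrow> x $ i) (lagrange_solutions g f)
    (sols (gradient_system (lagrangian_coeffs (($) (coeff_point f g)))))"
proof -
  let ?e = "\<lambda>(x :: complex ^ 'n, \<mu>). \<chi> j. case j of None \<Rightarrow> \<mu> | Some i \<Rightarrow> x $ i"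
  let ?a = "($) (coeff_point f g)"
  have mult_f: "multiaffine (complexify f)"
    by (rule multiaffine_if_coeffs_vanish) (simp add: lookup_complexify multiaffine_coeff_vanishes[OF f])
  have mult_l: "multiaffine (complexify g - Poly_Mapping.single 0 \<mu> * complexify f)" for \<mu>
    by (rule multiaffine_if_coeffs_vanish)
      (simp add: lookup_lagrangian multiaffine_coeff_vanishes[OF f] multiaffine_coeff_vanishes[OF g])
  have a: "?a (Inl S) = complex_of_real (Poly_Mapping.lookup f (multiaffine_monomial S))"
    "?a (Inr S) = complex_of_real (Poly_Mapping.lookup g (multiaffine_monomial S))" for S
    by (simp_all add: coeff_point_def)
  have eq_f: "lead_eq {} (gradient_system (lagrangian_coeffs ?a)) None (($) (?e (x, \<mu>)))
    = - mpoly_eval (complexify f) (($) x)" for x \<mu>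
    by (simp add: lead_eq_multiplier mpoly_eval_multiaffine[OF mult_f] a lookup_complexify)
  have eq_l: "lead_eq {} (gradient_system (lagrangian_coeffs ?a)) (Some i) (($) (?e (x, \<mu>)))
    = mpoly_eval (lagrange_poly g f \<mu> i) (($) x)" for x \<mu> i
    by (simp add: lead_eq_variable lagrange_poly_def mpoly_eval_partial_multiaffine[OF mult_l] a lookup_lagrangian)
  have mem: "?e (x, \<mu>) \<in> sols (gradient_system (lagrangian_coeffs ?a)) \<longleftrightarrow> (x, \<mu>) \<in> lagrange_solutions g f"
    for x \<mu>
  proof -
    have "?e (x, \<mu>) \<in> sols (gradient_system (lagrangian_coeffs ?a)) \<longleftrightarrow>
      (\<forall>j. lead_eq {} (gradient_system (lagrangian_coeffs ?a)) j (($) (?e (x, \<mu>))) = 0)"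
      by (simp only: sols_def mem_Collect_eq)
    also have "\<dots> \<longleftrightarrow> (x, \<mu>) \<in> lagrange_solutions g f"
      unfolding split_option_all eq_f eq_l lagrange_solutions_def by auto
    finally show ?thesis .
  qed
  show ?thesis
  proof (rule bij_betwI[where g = "\<lambda>y. (\<chi> i. y $ Some i, y $ None)"])
    show "?e \<in> lagrange_solutions g f \<rightarrow> sols (gradient_system (lagrangian_coeffs ?a))"
      using mem by fastforce
    have inv: "?e (\<chi> i. y $ Some i, y $ None) = y" for y
      by (auto simp: vec_eq_iff split: option.split)
    show "(\<lambda>y. (\<chi> i. y $ Some i, y $ None)) \<in> sols (gradient_system (lagrangian_coeffs ?a)) \<rightarrow> lagrange_solutions g f"
    proof
      fix y assume "y \<in> sols (gradient_system (lagrangian_coeffs ?a))"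
      then show "(\<chi> i. y $ Some i, y $ None) \<in> lagrange_solutions g f"
        using mem[of "\<chi> i. y $ Some i" "y $ None"] unfolding inv by simp
    qed
    show "(\<chi> i. ?e z $ Some i, ?e z $ None) = z" for z by (cases z) (simp add: vec_eq_iff)
    show "?e (\<chi> i. y $ Some i, y $ None) = y" for y by (rule inv)
  qed
qed

lemma lagrangian_coeffs_surj:
  fixes C :: "'n option set \<Rightarrow> complex"
  shows "\<exists>a. lagrangian_coeffs a = C"
proof -
  define a where "a k = (case k of Inl S \<Rightarrow> - C (insert None (Some ` S)) | Inr S \<Rightarrow> C (Some ` S))" for k
  have "lagrangian_coeffs a S = C S" for S
  proof (cases "None \<in> S")
    case True
    then have "insert None (Some ` (Some -` S)) = S" by (auto simp: image_iff)
    then show ?thesis using True by (simp add: lagrangian_coeffs_def a_def)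
  next
    case False
    then have "Some ` (Some -` S) = S" by (auto simp: image_iff) (metis not_None_eq)
    then show ?thesis using False by (simp add: lagrangian_coeffs_def a_def)
  qed
  then show ?thesis by blast
qed

section \<open>The algebraic degree\<close>

lemma card_derangements_cong:
  assumes "bij_betw h A B"
  shows "card (derangements A) = card (derangements B)"
proof -
  let ?F = "\<lambda>\<pi> x. if x \<in> B then h (\<pi> (inv_into A h x)) else x"
  have bij: "bij_betw ?F {\<pi>. \<pi> permutes A} {\<pi>. \<pi> permutes B}"
    by (rule bij_betw_permutations[OF assms])
  have fix_iff: "(\<forall>b\<in>B. ?F \<pi> b \<noteq> b) \<longleftrightarrow> (\<forall>a\<in>A. \<pi> a \<noteq> a)" if \<pi>: "\<pi> permutes A" for \<pi>
  proof -
    have B: "B = h ` A" and inj: "inj_on h A" using assms by (auto simp: bij_betw_def)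
    have "h (\<pi> a) = h a \<longleftrightarrow> \<pi> a = a" if "a \<in> A" for a
      using inj that \<pi> by (auto simp: inj_on_eq_iff permutes_in_image)
    then show ?thesis unfolding B by (auto simp: inv_into_f_f[OF inj])
  qed
  have "bij_betw ?F (derangements A) (derangements B)"
  proof (rule bij_betw_subset[OF bij])
    show "?F ` derangements A = derangements B"
    proof (intro equalityI subsetI)
      fix \<rho> assume "\<rho> \<in> ?F ` derangements A"
      then obtain \<pi> where \<pi>: "\<rho> = ?F \<pi>" "\<pi> permutes A" "\<forall>a\<in>A. \<pi> a \<noteq> a" by (auto simp: derangements_def)
      moreover have "?F \<pi> permutes B" using bij \<pi>(2) by (auto simp: bij_betw_def)
      ultimately show "\<rho> \<in> derangements B" using fix_iff[OF \<pi>(2)] by (simp add: derangements_def)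
    next
      fix \<rho> assume \<rho>: "\<rho> \<in> derangements B"
      then have "\<rho> \<in> ?F ` {\<pi>. \<pi> permutes A}" using bij by (simp add: bij_betw_def derangements_def)
      then obtain \<pi> where \<pi>: "\<rho> = ?F \<pi>" "\<pi> permutes A" by blast
      then have "\<pi> \<in> derangements A" using fix_iff[OF \<pi>(2)] \<rho> by (simp add: derangements_def)
      then show "\<rho> \<in> ?F ` derangements A" using \<pi>(1) by blast
    qed
  qed (auto simp: derangements_def)
  then show ?thesis by (rule bij_betw_same_card)
qed

theorem theorem6p1:
  "\<exists>V :: (complex ^ ('n::finite set + 'n set)) set.
     algebraic_subvariety V \<and> V \<noteq> UNIV \<and>
     (\<forall>f g :: ('n, real) mpoly.
        multiaffine f \<longrightarrow> multiaffine g \<longrightarrow>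
        Newt f = convex hull {v. \<forall>i. v $ i \<in> {0, 1}} \<longrightarrow>
        Newt g = convex hull {v. \<forall>i. v $ i \<in> {0, 1}} \<longrightarrow>
        coeff_point f g \<notin> V \<longrightarrow>
        finite (lagrange_solutions g f) \<and>
        algebraic_degree g f = card (derangements {0..CARD('n)}))"
proof -
  have card: "CARD('n option) = Suc CARD('n)" "2 \<le> CARD('n option)"
    using zero_less_card_finite[where 'a = 'n] by (simp_all add: card_UNIV_option)
  obtain D :: "('n option set \<Rightarrow> complex) \<Rightarrow> complex" and C0
    where D: "polyfun D" "D C0 \<noteq> 0" "\<And>C. D C \<noteq> 0 \<Longrightarrow> nondegenerate (gradient_system C)"
    using generic_gradient_system_nondegenerate[OF card(2)] by blast
  have "polyfun (\<lambda>a :: 'n set + 'n set \<Rightarrow> complex. lagrangian_coeffs a S)" for S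
    by (cases "None \<in> S") (simp_all add: lagrangian_coeffs_def polyfun.var polyfun_uminus)
  then have "polyfun (\<lambda>a :: 'n set + 'n set \<Rightarrow> complex. D (lagrangian_coeffs a))"
    by (rule polyfun_compose[OF D(1)])
  then obtain P where P: "\<And>a :: 'n set + 'n set \<Rightarrow> complex. mpoly_eval P a = D (lagrangian_coeffs a)"
    using polyfun_imp_mpoly by blast
  define V where "V = {a :: complex ^ ('n set + 'n set). \<forall>p\<in>{P}. mpoly_eval p (($) a) = 0}"
  obtain a0 where a0: "lagrangian_coeffs a0 = C0" using lagrangian_coeffs_surj by blast
  have "(\<chi> k. a0 k) \<notin> V"
  proof -
    have "(($) (\<chi> k. a0 k)) = a0" by auto
    then show ?thesis using D(2) a0 by (simp add: V_def P del: vec_lambda_eta)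
  qed
  moreover have "finite (lagrange_solutions g f) \<and>
      algebraic_degree g f = card (derangements {0..CARD('n)})"
    if f: "multiaffine f" and g: "multiaffine g" and out: "coeff_point f g \<notin> V"
    for f g :: "('n, real) mpoly"
  proof -
    let ?c = "gradient_system (lagrangian_coeffs (($) (coeff_point f g)))"
    have "nondegenerate ?c" using out by (intro D(3)) (simp add: V_def P)
    then have sols: "finite (sols ?c)" "card (sols ?c) = card (derangements (UNIV :: 'n option set))"
      using card_sols_nondegenerate[OF card(2)] by blast+
    obtain h where "bij_betw h (UNIV :: 'n option set) {0..CARD('n)}"
      using finite_same_card_bij[of "UNIV :: 'n option set" "{0..CARD('n)}"] card(1) by auto
    then have "card (derangements (UNIV :: 'n option set)) = card (derangements {0..CARD('n)})"
      by (rule card_derangements_cong)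
    then show ?thesis
      using lagrange_solutions_bij_betw_sols[OF f g] sols
      by (simp add: algebraic_degree_def bij_betw_same_card bij_betw_finite)
  qed
  moreover have "algebraic_subvariety V" unfolding algebraic_subvariety_def V_def by blast
  ultimately show ?thesis by (intro exI[of _ V]) auto
qed

end
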